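(* Assume $\alpha_1\alpha_2<1/4$ and let $Z_0=0$, $Z_t=\int_0^t(t/s)^A\,dB_s$ for $t>0$. Then: (1) The process $Z$ admits a continuous modification. (2) The process $Z$ (taken in its continuous modification) satisfies the stochastic integral equation $$Z_t=B_t+\int_0^t\frac1s\,A Z_s\,ds,\qquad t\ge0.$$
   Context: $\alpha_1,\alpha_2\in[-1,1]$, $A=\begin{pmatrix}0&\alpha_1\\ \alpha_2&0\end{pmatrix}$, $x^A:=e^{(\log x)A}$ for $x>0$, and $\{B_t\}_{t\ge0}$ is a two-dimensional standard Brownian motion (the same one in the definition of $Z$ and in the equation). *)

theory Defs
  imports "HOL-Probability.Probability"
begin

section \<open>Powers \<open>x\<^sup>A\<close> with a matrix exponent\<close>

text \<open>Square matrices are not an instance of \<open>real_normed_algebra_1\<close>, so the library's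
  \<open>exp\<close> does not apply to them; \<open>*\<close> and \<open>^\<close> on this type are componentwise.\<close>

primrec matrix_pow :: "real ^ 'n ^ 'n \<Rightarrow> nat \<Rightarrow> real ^ 'n ^ 'n" where
  "matrix_pow A 0 = mat 1"
| "matrix_pow A (Suc k) = A ** matrix_pow A k"

definition matrix_exp :: "real ^ 'n ^ 'n \<Rightarrow> real ^ 'n ^ 'n" where
  "matrix_exp A = (\<Sum>k. (1 / fact k) *\<^sub>R matrix_pow A k)"

definition matrix_powr :: "real \<Rightarrow> real ^ 'n ^ 'n \<Rightarrow> real ^ 'n ^ 'n" where
  "matrix_powr x A = matrix_exp (ln x *\<^sub>R A)"

section \<open>Brownian motion\<close>

text \<open>Processes have time set \<open>[0, \<infinity>)\<close>: values at negative times are irrelevant. The starting point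
  and the continuity of the paths are required almost surely only.
  Note that \<open>normal_density\<close> takes the standard deviation.\<close>

definition standard_brownian_motion :: "'a measure \<Rightarrow> (real \<Rightarrow> 'a \<Rightarrow> real) \<Rightarrow> bool" where
  "standard_brownian_motion M W \<longleftrightarrow>
     prob_space M \<and>
     (\<forall>t\<ge>0. W t \<in> borel_measurable M) \<and>
     (AE \<omega> in M. W 0 \<omega> = 0) \<and>
     (\<forall>n (\<tau> :: nat \<Rightarrow> real). 0 \<le> \<tau> 0 \<longrightarrow> (\<forall>i<n. \<tau> i < \<tau> (Suc i)) \<longrightarrow>
        prob_space.indep_vars M (\<lambda>_. borel) (\<lambda>i \<omega>. W (\<tau> (Suc i)) \<omega> - W (\<tau> i) \<omega>) {..<n}) \<and>
     (\<forall>s t. 0 \<le> s \<longrightarrow> s < t \<longrightarrow>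
        distributed M lborel (\<lambda>\<omega>. W t \<omega> - W s \<omega>) (normal_density 0 (sqrt (t - s)))) \<and>
     (AE \<omega> in M. continuous_on {0..} (\<lambda>t. W t \<omega>))"

text \<open>In several dimensions, the components are independent (as processes, that is, as random
  elements of the space of all paths with its product \<open>\<sigma>\<close>-algebra) one-dimensional standard
  Brownian motions.\<close>

definition standard_brownian_motion_vec ::
    "'a measure \<Rightarrow> (real \<Rightarrow> 'a \<Rightarrow> real ^ 'n) \<Rightarrow> bool" where
  "standard_brownian_motion_vec M B \<longleftrightarrow>
     (\<forall>j. standard_brownian_motion M (\<lambda>t \<omega>. B t \<omega> $ j)) \<and>
     prob_space.indep_vars M (\<lambda>_. Pi\<^sub>M {0..} (\<lambda>_. borel))
       (\<lambda>j \<omega>. \<lambda>t\<in>{0..}. B t \<omega> $ j) UNIV"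

section \<open>Stochastic integral of a deterministic matrix-valued function\<close>

definition partition_of :: "nat \<Rightarrow> (nat \<Rightarrow> real) \<Rightarrow> real \<Rightarrow> bool" where
  "partition_of n \<tau> t \<longleftrightarrow> \<tau> 0 = 0 \<and> \<tau> n = t \<and> (\<forall>i<n. \<tau> i < \<tau> (Suc i))"

definition step_fun ::
    "nat \<Rightarrow> (nat \<Rightarrow> real) \<Rightarrow> (nat \<Rightarrow> real ^ 'n ^ 'm) \<Rightarrow> real \<Rightarrow> real ^ 'n ^ 'm" where
  "step_fun n \<tau> c s = (\<Sum>i<n. indicator {\<tau> i<..\<tau> (Suc i)} s *\<^sub>R c i)"

definition step_integral ::
    "(real \<Rightarrow> 'a \<Rightarrow> real ^ 'n) \<Rightarrow> nat \<Rightarrow> (nat \<Rightarrow> real) \<Rightarrow> (nat \<Rightarrow> real ^ 'n ^ 'm) \<Rightarrow> 'a \<Rightarrow> real ^ 'm" where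
  "step_integral B n \<tau> c \<omega> = (\<Sum>i<n. c i *v (B (\<tau> (Suc i)) \<omega> - B (\<tau> i) \<omega>))"

text \<open>\<open>X\<close> is a version of \<open>\<integral>\<^sub>0\<^sup>t f(s) dB\<^sub>s\<close>: the \<open>L\<^sup>2\<close>-limit of the integrals of step functions
  converging to \<open>f\<close> in \<open>L\<^sup>2[0, t]\<close>. The norm on matrices is the Frobenius norm.\<close>

definition has_wiener_integral ::
    "'a measure \<Rightarrow> (real \<Rightarrow> 'a \<Rightarrow> real ^ 'n) \<Rightarrow> real \<Rightarrow> (real \<Rightarrow> real ^ 'n ^ 'm) \<Rightarrow>
      ('a \<Rightarrow> real ^ 'm) \<Rightarrow> bool" where
  "has_wiener_integral M B t f X \<longleftrightarrow>
     set_borel_measurable lborel {0..t} f \<and> X \<in> borel_measurable M \<and>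
     (\<exists>n \<tau> c. (\<forall>k. partition_of (n k) (\<tau> k) t) \<and>
        (\<lambda>k. \<integral>\<^sup>+s\<in>{0..t}. ennreal ((norm (step_fun (n k) (\<tau> k) (c k) s - f s))\<^sup>2) \<partial>lborel)
          \<longlonglongrightarrow> 0 \<and>
        (\<lambda>k. \<integral>\<^sup>+\<omega>. ennreal ((norm (step_integral B (n k) (\<tau> k) (c k) \<omega> - X \<omega>))\<^sup>2) \<partial>M)
          \<longlonglongrightarrow> 0)"

text \<open>Versions agree only almost surely; one of them is selected.\<close>

definition wiener_integral ::
    "'a measure \<Rightarrow> (real \<Rightarrow> 'a \<Rightarrow> real ^ 'n) \<Rightarrow> real \<Rightarrow> (real \<Rightarrow> real ^ 'n ^ 'm) \<Rightarrow> 'a \<Rightarrow> real ^ 'm" where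
  "wiener_integral M B t f = (SOME X. has_wiener_integral M B t f X)"

section \<open>Continuous modifications\<close>

definition continuous_modification ::
    "'a measure \<Rightarrow> (real \<Rightarrow> 'a \<Rightarrow> 'b :: euclidean_space) \<Rightarrow> (real \<Rightarrow> 'a \<Rightarrow> 'b) \<Rightarrow> bool" where
  "continuous_modification M Z Z' \<longleftrightarrow>
     (\<forall>t\<ge>0. Z' t \<in> borel_measurable M) \<and>
     (\<forall>t\<ge>0. AE \<omega> in M. Z' t \<omega> = Z t \<omega>) \<and>
     (\<forall>\<omega>\<in>space M. continuous_on {0..} (\<lambda>t. Z' t \<omega>))"

end

theory Submission
  imports Defs
begin

text \<open>
  Put \<open>E u = exp (u A)\<close>, so that \<open>(t / s)\<^sup>A = E (ln (t / s))\<close>. The derivative of this function of \<open>s\<close> is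
  \<open>- (1 / s) A (t / s)\<^sup>A\<close>, and integration by parts suggests
  \<open>\<integral>\<^sub>0\<^sup>t (t / s)\<^sup>A dB\<^sub>s = B\<^sub>t + A C\<^sub>t\<close> with \<open>C\<^sub>t = \<integral>\<^sub>0\<^sup>t (1 / s) (t / s)\<^sup>A B\<^sub>s ds\<close>.
  The right-hand side is defined path by path, and for it both claims are calculus.

  The integral \<open>C\<^sub>t\<close> converges because of the hypothesis on \<open>\<alpha>1 \<alpha>2\<close>. As \<open>A\<^sup>2\<close> is \<open>\<alpha>1 \<alpha>2\<close> times the identity,
  \<open>exp (u A)\<close> is an explicit combination of \<open>mat 1\<close> and \<open>A\<close> (\<open>matrix_exp_square_scalar\<close>), whose norm is at most
  \<open>K exp (\<kappa> u)\<close> for \<open>u \<ge> 0\<close>, for some \<open>\<kappa> < 1 / 2\<close> (\<open>subcritical_flow_matrix_exp\<close>). So the integrand is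
  at most a multiple of \<open>s\<^sup>-\<^sup>1\<^sup>-\<^sup>\<kappa> \<bar>B\<^sub>s\<bar>\<close>, and since the second moment of \<open>B\<^sub>s\<close> is proportional to \<open>s\<close>, this is integrable near
  \<open>0\<close> for almost all paths (\<open>AE_admissible\<close>).

  For such a path, \<open>C\<close> satisfies \<open>C' = (1 / t) (B + A C)\<close> for \<open>t > 0\<close> and tends to \<open>0\<close> at \<open>0\<close>, so \<open>Z = B + A C\<close> is
  continuous and integrating the differential equation gives \<open>C\<^sub>t = \<integral>\<^sub>0\<^sup>t (1 / s) Z\<^sub>s ds\<close>
  (\<open>conv_integral_equation\<close>); multiplication by \<open>A\<close> yields the equation for \<open>Z\<close>.

  It remains to identify \<open>B\<^sub>t + A C\<^sub>t\<close> with the Wiener integral (\<open>has_wiener_integral_flow\<close>). Step functions that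
  take the values of \<open>(t / s)\<^sup>A\<close> at right endpoints converge in \<open>L\<^sup>2[0, t]\<close>. By Abel summation, the
  difference of their integrals and \<open>B\<^sub>t + A C\<^sub>t\<close> is an integral over \<open>s\<close> of the increment of \<open>B\<close> between \<open>s\<close> and
  the grid point to its left, weighted with the singular kernel; a weighted Cauchy-Schwarz inequality and
  an exchange of the integrals show that it tends to \<open>0\<close> in \<open>L\<^sup>2\<close>. The Wiener integral being unique up to null sets
  (\<open>has_wiener_integral_unique\<close>), the selected version is almost surely this one. Finally, continuous processes
  that agree almost surely at each time agree almost surely at all times (\<open>AE_eq_processes\<close>), which
  carries the equation over to every continuous modification.
\<close>

section \<open>The exponential of a matrix whose square is scalar\<close>

lemma norm_matrix_vector_mult_le:
  fixes A :: "real ^ 'n ^ 'm"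
  shows "norm (A *v x) \<le> norm A * norm x"
proof -
  have "norm (A *v x) = L2_set (\<lambda>i. (A *v x) $ i) UNIV"
    by (simp add: norm_vec_def L2_set_def)
  also have "\<dots> = L2_set (\<lambda>i. \<bar>A $ i \<bullet> x\<bar>) UNIV"
    by (simp add: L2_set_def matrix_mult_dot)
  also have "\<dots> \<le> L2_set (\<lambda>i. norm (A $ i) * norm x) UNIV"
    by (intro L2_set_mono) (auto simp: Cauchy_Schwarz_ineq2)
  also have "\<dots> = norm A * norm x"
    by (simp add: norm_vec_def[of A] L2_set_left_distrib)
  finally show ?thesis .
qed

lemma bounded_bilinear_matrix_vector_mult:
  "bounded_bilinear ((*v) :: real ^ 'n ^ 'm \<Rightarrow> real ^ 'n \<Rightarrow> real ^ 'm)"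
proof
  show "\<exists>K. \<forall>(A :: real ^ 'n ^ 'm) x. norm (A *v x) \<le> norm A * norm x * K"
    by (rule exI[of _ 1]) (simp add: norm_matrix_vector_mult_le)
qed (simp_all add: algebra_simps scaleR_matrix_vector_assoc matrix_vector_mult_scaleR)

lemma bounded_bilinear_matrix_matrix_mult:
  "bounded_bilinear ((**) :: real ^ 'k ^ 'm \<Rightarrow> real ^ 'n ^ 'k \<Rightarrow> real ^ 'n ^ 'm)"
  unfolding bilinear_conv_bounded_bilinear[symmetric] bilinear_def linear_iff
  by (auto simp: matrix_matrix_mult_def vec_eq_iff algebra_simps sum.distrib sum_distrib_left)

text \<open>The functions \<open>cosh (\<surd>p u)\<close> and \<open>sinh (\<surd>p u) / \<surd>p\<close>, continued to \<open>p \<le> 0\<close> so that they stay real.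
They are the entire functions \<open>\<Sum>k. p\<^sup>k u\<^sup>2\<^sup>k / (2k)!\<close> and \<open>\<Sum>k. p\<^sup>k u\<^sup>2\<^sup>k\<^sup>+\<^sup>1 / (2k + 1)!\<close>, and the
coefficients of \<open>mat 1\<close> and \<open>A\<close> in \<open>exp (u A)\<close> whenever \<open>A\<^sup>2 = p\<close>.\<close>

definition cosh_sqrt :: "real \<Rightarrow> real \<Rightarrow> real" where
  "cosh_sqrt p u = (if p > 0 then cosh (sqrt p * u) else cos (sqrt (- p) * u))"

definition sinh_sqrt :: "real \<Rightarrow> real \<Rightarrow> real" where
  "sinh_sqrt p u = (if p > 0 then sinh (sqrt p * u) / sqrt p
     else if p = 0 then u else sin (sqrt (- p) * u) / sqrt (- p))"

lemma cosh_sqrt_0 [simp]: "cosh_sqrt p 0 = 1" and sinh_sqrt_0 [simp]: "sinh_sqrt p 0 = 0"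
  by (simp_all add: cosh_sqrt_def sinh_sqrt_def)

lemma cosh_sqrt_add:
  "cosh_sqrt p (u + v) = cosh_sqrt p u * cosh_sqrt p v + p * sinh_sqrt p u * sinh_sqrt p v"
  by (auto simp: cosh_sqrt_def sinh_sqrt_def distrib_left cosh_add cos_add field_simps)

lemma sinh_sqrt_add:
  "sinh_sqrt p (u + v) = sinh_sqrt p u * cosh_sqrt p v + cosh_sqrt p u * sinh_sqrt p v"
  by (auto simp: cosh_sqrt_def sinh_sqrt_def distrib_left sinh_add sin_add field_simps)

lemma cosh_sqrt_deriv [derivative_intros]:
  "(cosh_sqrt p has_real_derivative p * sinh_sqrt p u) (at u)"
proof (cases "p > 0")
  case False
  have "p * s / sqrt (- p) = - (s * sqrt (- p))" for s
  proof -
    have "p * s / sqrt (- p) = - ((- p / sqrt (- p)) * s)" by simp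
    also have "- p / sqrt (- p) = sqrt (- p)" using False by (intro real_div_sqrt) simp
    finally show ?thesis by simp
  qed
  then show ?thesis
    using False unfolding cosh_sqrt_def[abs_def] sinh_sqrt_def
    by (auto intro!: derivative_eq_intros)
qed (auto intro!: derivative_eq_intros simp: cosh_sqrt_def[abs_def] sinh_sqrt_def field_simps)

lemma sinh_sqrt_deriv [derivative_intros]:
  "(sinh_sqrt p has_real_derivative cosh_sqrt p u) (at u)"
proof -
  consider "p > 0" | "p = 0" | "p < 0" by linarith
  then show ?thesis
    by cases (auto intro!: derivative_eq_intros simp: cosh_sqrt_def sinh_sqrt_def[abs_def] mult.assoc)
qed

lemma power_sqrt_even: "even k \<Longrightarrow> p \<ge> 0 \<Longrightarrow> sqrt p ^ k = p ^ (k div 2)"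
  by (metis dvd_mult_div_cancel power_mult real_sqrt_pow2)

lemma power_sqrt_odd: "odd k \<Longrightarrow> p \<ge> 0 \<Longrightarrow> sqrt p ^ k = sqrt p * p ^ (k div 2)"
  by (metis odd_two_times_div_two_succ power_Suc power_mult real_sqrt_pow2 Suc_eq_plus1)

lemma cosh_sqrt_sums:
  "(\<lambda>k. if even k then p ^ (k div 2) * u ^ k / fact k else 0) sums cosh_sqrt p u"
proof (cases "p > 0")
  case True
  then show ?thesis
    using cosh_converges[of "sqrt p * u"]
    by (auto simp: cosh_sqrt_def power_mult_distrib power_sqrt_even divide_inverse mult_ac cong: if_cong)
next
  case False
  have "cos_coeff k *\<^sub>R (sqrt (- p) * u) ^ k = (if even k then p ^ (k div 2) * u ^ k / fact k else 0)" for k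
    using False power_minus[of p "k div 2"] power_minus[of "-p" "k div 2"]
    by (auto simp: cos_coeff_def power_mult_distrib power_sqrt_even)
  then show ?thesis
    using cos_converges[of "sqrt (- p) * u"] False by (simp add: cosh_sqrt_def)
qed

lemma sinh_sqrt_sums:
  "(\<lambda>k. if even k then 0 else p ^ (k div 2) * u ^ k / fact k) sums sinh_sqrt p u"
proof -
  consider "p > 0" | "p = 0" | "p < 0" by linarith
  then show ?thesis
  proof cases
    case 1
    have "(if even k then 0 else (sqrt p * u) ^ k /\<^sub>R fact k) / sqrt p =
        (if even k then 0 else p ^ (k div 2) * u ^ k / fact k)" for k
      using 1 by (auto simp: power_mult_distrib power_sqrt_odd field_simps)
    then show ?thesis
      using sums_divide[OF sinh_converges[of "sqrt p * u"], of "sqrt p"] 1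
      by (simp add: sinh_sqrt_def)
  next
    case 2
    have "(\<lambda>k. if even k then 0 else p ^ (k div 2) * u ^ k / fact k) = (\<lambda>k. if k = 1 then u else 0)"
    proof
      fix k :: nat
      have "k div 2 \<noteq> 0" if "odd k" "k \<noteq> 1" using that by (cases k) (auto elim!: evenE)
      then show "(if even k then 0 else p ^ (k div 2) * u ^ k / fact k) = (if k = 1 then u else 0)"
        using 2 by auto
    qed
    then show ?thesis
      using sums_single[of 1 "\<lambda>_. u"] 2 by (simp add: sinh_sqrt_def)
  next
    case 3
    have "(sin_coeff k *\<^sub>R (sqrt (- p) * u) ^ k) / sqrt (- p) =
        (if even k then 0 else p ^ (k div 2) * u ^ k / fact k)" for k
    proof (cases "even k")
      case False
      then have "(k - Suc 0) div 2 = k div 2" by (auto elim!: oddE)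
      moreover have "(-1) ^ (k div 2) * (- p) ^ (k div 2) = p ^ (k div 2)"
        by (simp flip: power_mult_distrib)
      ultimately show ?thesis
        using False 3 by (simp add: sin_coeff_def power_mult_distrib power_sqrt_odd)
    qed (simp add: sin_coeff_def)
    then show ?thesis
      using sums_divide[OF sin_converges[of "sqrt (- p) * u"], of "sqrt (- p)"] 3
      by (simp add: sinh_sqrt_def)
  qed
qed

text \<open>Only positive \<open>p\<close> produces exponential growth, of rate \<open>\<surd>p\<close>; for \<open>p \<le> 0\<close> the functions are
trigonometric, or linear in the case \<open>p = 0\<close> of the next lemma, where the strict inequality
\<open>0 < \<kappa>\<close> absorbs the linear factor.\<close>

lemma cosh_sqrt_growth:
  assumes "p < \<kappa>\<^sup>2" "0 < \<kappa>" "0 \<le> u"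
  shows "\<bar>cosh_sqrt p u\<bar> \<le> exp (\<kappa> * u)"
proof (cases "p > 0")
  case True
  have "sqrt p * u \<le> \<kappa> * u"
    using assms real_sqrt_less_mono[of p "\<kappa>\<^sup>2"] by (intro mult_right_mono) auto
  moreover have "exp (- (sqrt p * u)) \<le> exp (sqrt p * u)"
    using True assms by simp
  moreover have "exp (sqrt p * u) \<le> exp (\<kappa> * u)"
    using calculation(1) by simp
  ultimately have "exp (sqrt p * u) + exp (- (sqrt p * u)) \<le> 2 * exp (\<kappa> * u)"
    by linarith
  then have "cosh (sqrt p * u) \<le> exp (\<kappa> * u)"
    by (simp add: cosh_def)
  then show ?thesis
    using True by (simp add: cosh_sqrt_def cosh_real_nonneg)
next
  case False
  have "\<bar>cos (sqrt (- p) * u)\<bar> \<le> 1" by simp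
  also have "\<dots> \<le> exp (\<kappa> * u)" using assms by simp
  finally show ?thesis using False by (simp add: cosh_sqrt_def)
qed

lemma sinh_sqrt_growth:
  assumes "p < \<kappa>\<^sup>2" "0 < \<kappa>"
  shows "\<exists>K\<ge>0. \<forall>u\<ge>0. \<bar>sinh_sqrt p u\<bar> \<le> K * exp (\<kappa> * u)"
proof -
  consider "p > 0" | "p = 0" | "p < 0" by linarith
  then show ?thesis
  proof cases
    case 1
    have "\<bar>sinh_sqrt p u\<bar> \<le> 1 / sqrt p * exp (\<kappa> * u)" if "u \<ge> 0" for u
    proof -
      have "\<bar>sinh (sqrt p * u)\<bar> \<le> cosh (sqrt p * u)"
        using 1 that by (simp add: sinh_le_cosh_real)
      then show ?thesis
        using cosh_sqrt_growth[OF assms that] 1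
        by (simp add: sinh_sqrt_def cosh_sqrt_def cosh_real_nonneg divide_right_mono)
    qed
    then show ?thesis using 1 by (intro exI[of _ "1 / sqrt p"]) auto
  next
    case 2
    have "\<bar>sinh_sqrt p u\<bar> \<le> 1 / \<kappa> * exp (\<kappa> * u)" if "u \<ge> 0" for u
      using exp_ge_add_one_self[of "\<kappa> * u"] assms that 2
      by (auto simp: sinh_sqrt_def field_simps intro: order.trans[OF _ exp_ge_add_one_self])
    then show ?thesis using assms by (intro exI[of _ "1 / \<kappa>"]) auto
  next
    case 3
    have "\<bar>sinh_sqrt p u\<bar> \<le> 1 / sqrt (- p) * exp (\<kappa> * u)" if "u \<ge> 0" for u
    proof -
      have "\<bar>sin (sqrt (- p) * u)\<bar> \<le> 1" by simp
      also have "\<dots> \<le> exp (\<kappa> * u)" using assms that by simp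
      finally show ?thesis
        using 3 by (simp add: sinh_sqrt_def divide_right_mono)
    qed
    then show ?thesis using 3 by (intro exI[of _ "1 / sqrt (- p)"]) auto
  qed
qed

text \<open>Since \<open>A\<^sup>2\<close> is scalar, the powers of \<open>A\<close> alternate between multiples of the identity and of \<open>A\<close>, and
the exponential series splits into its even and its odd part.\<close>

lemma matrix_pow_square_scalar:
  fixes A :: "real ^ 'n ^ 'n"
  assumes "A ** A = p *\<^sub>R mat 1"
  shows "matrix_pow (u *\<^sub>R A) k =
    (if even k then (p ^ (k div 2) * u ^ k) *\<^sub>R mat 1 else (p ^ (k div 2) * u ^ k) *\<^sub>R A)"
proof (induction k)
  case (Suc k)
  interpret mm: bounded_bilinear "(**) :: real ^ 'n ^ 'n \<Rightarrow> real ^ 'n ^ 'n \<Rightarrow> real ^ 'n ^ 'n"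
    by (rule bounded_bilinear_matrix_matrix_mult)
  show ?case
    using Suc assms by (auto simp: mm.scaleR_left mm.scaleR_right elim!: evenE oddE)
qed simp

lemma matrix_exp_square_scalar:
  fixes A :: "real ^ 'n ^ 'n"
  assumes "A ** A = p *\<^sub>R mat 1"
  shows "matrix_exp (u *\<^sub>R A) = cosh_sqrt p u *\<^sub>R mat 1 + sinh_sqrt p u *\<^sub>R A"
proof -
  have "(1 / fact k) *\<^sub>R matrix_pow (u *\<^sub>R A) k =
      (if even k then p ^ (k div 2) * u ^ k / fact k else 0) *\<^sub>R mat 1 +
      (if even k then 0 else p ^ (k div 2) * u ^ k / fact k) *\<^sub>R A" for k
    by (simp add: matrix_pow_square_scalar[OF assms])
  then have "(\<lambda>k. (1 / fact k) *\<^sub>R matrix_pow (u *\<^sub>R A) k) sums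
      (cosh_sqrt p u *\<^sub>R mat 1 + sinh_sqrt p u *\<^sub>R A)"
    using sums_add[OF sums_scaleR_left[OF cosh_sqrt_sums] sums_scaleR_left[OF sinh_sqrt_sums]]
    by simp
  then show ?thesis
    unfolding matrix_exp_def by (rule sums_unique[symmetric])
qed

text \<open>The properties of \<open>E u = exp (u A)\<close> from which everything else follows. The bound \<open>1 / 2\<close> on the growth
rate \<open>\<kappa>\<close> makes \<open>(t / s)\<^sup>A\<close>, that is \<open>E (ln (t / s))\<close>, square integrable in \<open>s\<close> near \<open>0\<close>; it
is matched there by the size \<open>\<surd>s\<close> of Brownian motion. That \<open>\<kappa>\<close> is positive makes
\<open>t powr \<kappa>\<close> vanish as \<open>t\<close> tends to \<open>0\<close>, which gives continuity at the origin.\<close>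

locale subcritical_flow =
  fixes A :: "real ^ 'n ^ 'n" and E :: "real \<Rightarrow> real ^ 'n ^ 'n" and K \<kappa> :: real
  assumes E_0: "E 0 = mat 1"
    and E_add: "E (u + v) = E u ** E v"
    and E_deriv: "(E has_vector_derivative A ** E u) (at u)"
    and E_bound: "u \<ge> 0 \<Longrightarrow> norm (E u) \<le> K * exp (\<kappa> * u)"
    and lambda_pos: "0 < \<kappa>" and lambda_less: "\<kappa> < 1 / 2"

text \<open>The growth rate can be any number in \<open>(0, 1/2)\<close> above \<open>\<surd>p\<close>; the midpoint of \<open>\<surd>p\<close> and \<open>1 / 2\<close>
is chosen, with \<open>0\<close> in place of \<open>\<surd>p\<close> if \<open>p \<le> 0\<close>.\<close>

lemma subcritical_flow_matrix_exp:
  fixes A :: "real ^ 'n ^ 'n"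
  assumes sq: "A ** A = p *\<^sub>R mat 1" and p: "p < 1 / 4"
  shows "\<exists>K \<kappa>. subcritical_flow A (\<lambda>u. matrix_exp (u *\<^sub>R A)) K \<kappa>"
proof -
  interpret mm: bounded_bilinear "(**) :: real ^ 'n ^ 'n \<Rightarrow> real ^ 'n ^ 'n \<Rightarrow> real ^ 'n ^ 'n"
    by (rule bounded_bilinear_matrix_matrix_mult)
  define \<kappa> where "\<kappa> = (if p > 0 then (sqrt p + 1 / 2) / 2 else 1 / 4)"
  then have lam: "0 < \<kappa>" "\<kappa> < 1 / 2" and "p < \<kappa>\<^sup>2"
  proof -
    have "sqrt p < 1 / 2"
      using real_sqrt_less_mono[OF p] by (simp add: real_sqrt_divide)
    then show "0 < \<kappa>" "\<kappa> < 1 / 2"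
      by (auto simp: \<kappa>_def add_pos_pos)
    show "p < \<kappa>\<^sup>2"
    proof (cases "p > 0")
      case True
      then have "(sqrt p)\<^sup>2 < \<kappa>\<^sup>2"
        using \<open>sqrt p < 1 / 2\<close> by (intro power_strict_mono) (auto simp: \<kappa>_def)
      then show ?thesis using True by simp
    qed (use \<open>0 < \<kappa>\<close> in \<open>auto intro: order.strict_trans1[of _ 0]\<close>)
  qed
  then obtain C where C: "C \<ge> 0" "\<And>u. u \<ge> 0 \<Longrightarrow> \<bar>sinh_sqrt p u\<bar> \<le> C * exp (\<kappa> * u)"
    using sinh_sqrt_growth by blast
  have "norm (cosh_sqrt p u *\<^sub>R mat 1 + sinh_sqrt p u *\<^sub>R A) \<le>
      (norm (mat 1 :: real ^ 'n ^ 'n) + C * norm A) * exp (\<kappa> * u)" if "u \<ge> 0" for u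
  proof -
    have "norm (cosh_sqrt p u *\<^sub>R mat 1 + sinh_sqrt p u *\<^sub>R A) \<le>
        \<bar>cosh_sqrt p u\<bar> * norm (mat 1 :: real ^ 'n ^ 'n) + \<bar>sinh_sqrt p u\<bar> * norm A"
      by (rule order.trans[OF norm_triangle_ineq]) simp
    also have "\<dots> \<le> exp (\<kappa> * u) * norm (mat 1 :: real ^ 'n ^ 'n) + (C * exp (\<kappa> * u)) * norm A"
      by (intro add_mono mult_right_mono cosh_sqrt_growth[OF \<open>p < \<kappa>\<^sup>2\<close> lam(1) that] C(2)[OF that]) auto
    finally show ?thesis by (simp add: algebra_simps)
  qed
  moreover have "((\<lambda>u. cosh_sqrt p u *\<^sub>R mat 1 + sinh_sqrt p u *\<^sub>R A) has_vector_derivative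
      A ** (cosh_sqrt p u *\<^sub>R mat 1 + sinh_sqrt p u *\<^sub>R A)) (at u)" for u
    by (auto intro!: derivative_eq_intros simp: mm.add_right mm.scaleR_right sq)
  ultimately have "subcritical_flow A (\<lambda>u. matrix_exp (u *\<^sub>R A)) (norm (mat 1 :: real ^ 'n ^ 'n) + C * norm A) \<kappa>"
    unfolding matrix_exp_square_scalar[OF sq]
    using lam by unfold_locales
      (simp_all add: cosh_sqrt_add sinh_sqrt_add mm.add_left mm.add_right mm.scaleR_left mm.scaleR_right
        sq algebra_simps)
  then show ?thesis by blast
qed

section \<open>The integral equation for a single path\<close>

lemma borel_measurable_matrix_vector_mult [measurable]:
  fixes f :: "'a \<Rightarrow> real ^ 'n ^ 'm"
  assumes "f \<in> borel_measurable M" "g \<in> borel_measurable M"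
  shows "(\<lambda>x. f x *v g x) \<in> borel_measurable M"
proof (rule borel_measurable_continuous_Pair[OF assms])
  interpret bounded_bilinear "(*v) :: real ^ 'n ^ 'm \<Rightarrow> real ^ 'n \<Rightarrow> real ^ 'm"
    by (rule bounded_bilinear_matrix_vector_mult)
  show "continuous_on UNIV (\<lambda>x :: (real ^ 'n ^ 'm) \<times> (real ^ 'n). fst x *v snd x)"
    by (intro continuous_on continuous_intros)
qed

lemma set_integrable_powr:
  fixes a t :: real
  assumes "a > -1" "t \<ge> 0"
  shows "set_integrable lborel {0..t} (\<lambda>s. s powr a)"
proof -
  have "(\<lambda>s. s powr a) absolutely_integrable_on {0..t}"
    using has_integral_powr_from_0[OF assms]
    by (intro nonnegative_absolutely_integrable_1) (auto simp: integrable_on_def)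
  then show ?thesis
    unfolding set_integrable_def by (subst (asm) integrable_completion) auto
qed

context subcritical_flow
begin

definition flow_kernel :: "real \<Rightarrow> real \<Rightarrow> real ^ 'n ^ 'n" where
  "flow_kernel t s = (1 / s) *\<^sub>R E (ln (t / s))"

text \<open>The name refers to the logarithmic time scale, on which this is a convolution of the path
with the flow: with \<open>t = exp x\<close> and \<open>s = exp y\<close> it is the integral of \<open>E (x - y) *v b (exp y)\<close> over \<open>y \<le> x\<close>.\<close>

definition conv :: "(real \<Rightarrow> real ^ 'n) \<Rightarrow> real \<Rightarrow> real ^ 'n" where
  "conv b t = (LINT s:{0..t}|lborel. flow_kernel t s *v b s)"

text \<open>The weight \<open>s powr (- 1 - \<kappa>)\<close> bounds the growth of \<open>flow_kernel t s\<close> as \<open>s\<close> tends to \<open>0\<close>, so that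
admissibility makes the integral in \<open>conv\<close> absolutely convergent.\<close>

definition admissible :: "(real \<Rightarrow> real ^ 'n) \<Rightarrow> bool" where
  "admissible b \<longleftrightarrow> continuous_on {0..} b \<and> b 0 = 0 \<and>
    (\<forall>t\<ge>0. set_integrable lborel {0..t} (\<lambda>s. s powr (- 1 - \<kappa>) * norm (b s)))"

lemma K_nonneg: "0 \<le> K"
  using E_bound[of 0] norm_ge_zero[of "E 0"] by (simp del: norm_ge_zero)

lemma continuous_on_E [continuous_intros]:
  "continuous_on S f \<Longrightarrow> continuous_on S (\<lambda>x. E (f x))"
  by (rule continuous_on_compose2[of UNIV E])
    (auto intro!: continuous_at_imp_continuous_on has_vector_derivative_continuous E_deriv)

lemma borel_measurable_E [measurable]: "E \<in> borel_measurable borel"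
  by (intro borel_measurable_continuous_onI continuous_on_E continuous_on_id)

lemma borel_measurable_kernel [measurable]: "(\<lambda>s. flow_kernel t s) \<in> borel_measurable borel"
  unfolding flow_kernel_def by measurable

lemma norm_E_ln_le:
  assumes "0 < s" "s \<le> t"
  shows "norm (E (ln (t / s))) \<le> K * (t powr \<kappa> * s powr (- \<kappa>))"
proof -
  have "norm (E (ln (t / s))) \<le> K * exp (\<kappa> * ln (t / s))"
    using assms by (intro E_bound) simp
  also have "exp (\<kappa> * ln (t / s)) = t powr \<kappa> * s powr (- \<kappa>)"
    using assms by (simp add: powr_def ln_div algebra_simps flip: exp_add)
  finally show ?thesis .
qed

lemma norm_kernel_le:
  assumes "0 \<le> s" "s \<le> t"
  shows "norm (flow_kernel t s *v x) \<le> K * t powr \<kappa> * (s powr (- 1 - \<kappa>) * norm x)"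
proof (cases "s = 0")
  case False
  have "norm (flow_kernel t s *v x) \<le> norm (flow_kernel t s) * norm x"
    by (rule norm_matrix_vector_mult_le)
  also have "norm (flow_kernel t s) \<le> (1 / s) * (K * (t powr \<kappa> * s powr (- \<kappa>)))"
    unfolding flow_kernel_def using norm_E_ln_le[of s t] assms False by (simp add: divide_right_mono)
  also have "\<dots> = K * t powr \<kappa> * s powr (- 1 - \<kappa>)"
    using assms False by (simp add: powr_diff powr_minus field_simps)
  finally show ?thesis by (simp add: mult_right_mono mult.assoc)
qed (simp add: flow_kernel_def)

lemma admissible_measurable:
  assumes "admissible b"
  shows "(\<lambda>s. indicator {0..t} s *\<^sub>R b s) \<in> borel_measurable borel"
  using assms unfolding admissible_def
  by (intro borel_measurable_continuous_on_indicator) (auto elim: continuous_on_subset)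

lemma kernel_integrable:
  assumes b: "admissible b" and t: "0 \<le> t"
  shows "set_integrable lborel {0..t} (\<lambda>s. flow_kernel t s *v b s)"
  unfolding set_integrable_def
proof (rule Bochner_Integration.integrable_bound)
  show "integrable lborel (\<lambda>s. K * t powr \<kappa> *\<^sub>R (indicator {0..t} s *\<^sub>R (s powr (- 1 - \<kappa>) * norm (b s))))"
    using b t unfolding admissible_def set_integrable_def by (intro integrable_mult_right integrable_scaleR_right) auto
  have "(\<lambda>s. flow_kernel t s *v (indicator {0..t} s *\<^sub>R b s)) \<in> borel_measurable lborel"
    using admissible_measurable[OF b] by measurable
  then show "(\<lambda>s. indicator {0..t} s *\<^sub>R (flow_kernel t s *v b s)) \<in> borel_measurable lborel"
    by (simp add: matrix_vector_mult_scaleR)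
  show "AE s in lborel. norm (indicator {0..t} s *\<^sub>R (flow_kernel t s *v b s))
      \<le> norm (K * t powr \<kappa> *\<^sub>R (indicator {0..t} s *\<^sub>R (s powr (- 1 - \<kappa>) * norm (b s))))"
    using norm_kernel_le K_nonneg
    by (auto simp: abs_mult mult.assoc split: split_indicator)
qed

lemma norm_conv_le:
  assumes b: "admissible b" and t: "0 \<le> t" "t \<le> T"
  shows "norm (conv b t) \<le> K * t powr \<kappa> * (LINT s:{0..T}|lborel. s powr (- 1 - \<kappa>) * norm (b s))"
proof -
  have int: "set_integrable lborel {0..u} (\<lambda>s. s powr (- 1 - \<kappa>) * norm (b s))" if "u \<ge> 0" for u
    using b that by (simp add: admissible_def)
  have "norm (conv b t) \<le> (LINT s:{0..t}|lborel. norm (flow_kernel t s *v b s))"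
    unfolding conv_def by (rule set_integral_norm_bound[OF kernel_integrable[OF b t(1)]])
  also have "\<dots> \<le> (LINT s:{0..t}|lborel. K * t powr \<kappa> * (s powr (- 1 - \<kappa>) * norm (b s)))"
    using t by (intro set_integral_mono set_integrable_norm kernel_integrable b set_integrable_mult_right
      int norm_kernel_le) auto
  also have "\<dots> = K * t powr \<kappa> * (LINT s:{0..t}|lborel. s powr (- 1 - \<kappa>) * norm (b s))"
    by simp
  also have "\<dots> \<le> K * t powr \<kappa> * (LINT s:{0..T}|lborel. s powr (- 1 - \<kappa>) * norm (b s))"
    using t K_nonneg int[of T] int[of t]
    unfolding set_lebesgue_integral_def set_integrable_def
    by (intro mult_left_mono integral_mono) (auto split: split_indicator)
  finally show ?thesis .
qed

lemma conv_0 [simp]: "conv b 0 = 0"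
proof -
  have "(\<lambda>s. indicator {0..0} s *\<^sub>R (flow_kernel 0 s *v b s)) = (\<lambda>_. 0)"
    by (auto simp: flow_kernel_def split: split_indicator)
  then show ?thesis by (simp add: conv_def set_lebesgue_integral_def)
qed

text \<open>By the group law, \<open>conv b t = E (ln t) *v G t\<close>, where \<open>G\<close> is the primitive from \<open>0\<close> of
\<open>(1 / s) *\<^sub>R (E (- ln s) *v b s)\<close>. The product rule then gives the linear differential equation that
variation of constants solves.\<close>

lemma conv_has_vector_derivative:
  assumes b: "admissible b" and t: "0 < t"
  shows "(conv b has_vector_derivative (1 / t) *\<^sub>R (b t + A *v conv b t)) (at t)"
proof -
  interpret mv: bounded_bilinear "(*v) :: real ^ 'n ^ 'n \<Rightarrow> real ^ 'n \<Rightarrow> real ^ 'n"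
    by (rule bounded_bilinear_matrix_vector_mult)
  define g where "g s = (1 / s) *\<^sub>R (E (- ln s) *v b s)" for s
  define G where "G u = integral {0..u} g" for u
  have kernel_g: "flow_kernel u s *v b s = E (ln u) *v g s" if "0 \<le> s" "0 < u" for s u
  proof (cases "s = 0")
    case False
    then have "E (ln (u / s)) = E (ln u) ** E (- ln s)"
      using that by (simp add: ln_div flip: E_add)
    then show ?thesis
      by (simp add: flow_kernel_def g_def mv.scaleR_left mv.scaleR_right matrix_vector_mul_assoc)
  qed (simp add: flow_kernel_def g_def)
  have g_kernel: "g s = E (- ln u) *v (flow_kernel u s *v b s)" if "0 \<le> s" "0 < u" for s u
    using kernel_g[OF that] by (simp add: matrix_vector_mul_assoc E_0 flip: E_add)
  have g_int: "set_integrable lborel {0..u} g" if "0 < u" for u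
  proof -
    have "set_integrable lborel {0..u} (\<lambda>s. E (- ln u) *v (flow_kernel u s *v b s))"
      using integrable_bounded_linear[OF mv.bounded_linear_right[of "E (- ln u)"]
          kernel_integrable[OF b, of u, unfolded set_integrable_def]] that
      by (simp add: set_integrable_def mv.scaleR_right)
    then show ?thesis
      using g_kernel[of _ u] that by (subst set_integrable_cong[OF refl refl]) auto
  qed
  have conv_G: "conv b u = E (ln u) *v G u" if "0 < u" for u
  proof -
    have "conv b u = (LINT s:{0..u}|lborel. E (ln u) *v g s)"
      unfolding conv_def using that kernel_g by (intro set_lebesgue_integral_cong) auto
    also have "\<dots> = E (ln u) *v (LINT s:{0..u}|lborel. g s)"
      using g_int[OF that] unfolding set_lebesgue_integral_def set_integrable_def
      by (simp add: integral_bounded_linear[OF mv.bounded_linear_right, symmetric] flip: mv.scaleR_right)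
    finally show ?thesis
      using set_borel_integral_eq_integral(2)[OF g_int[OF that]] by (simp add: G_def)
  qed
  have "(G has_vector_derivative g t) (at t)"
  proof -
    have "isCont g t"
    proof -
      have "continuous_on {0<..} g"
        unfolding g_def using b unfolding admissible_def
        by (intro continuous_intros mv.continuous_on) (auto elim: continuous_on_subset)
      then show ?thesis using t by (simp add: continuous_on_eq_continuous_at)
    qed
    then have "(G has_vector_derivative g t) (at t within {0..t + 1} - {})"
      unfolding G_def using t set_borel_integral_eq_integral(1)[OF g_int[of "t + 1"]]
      by (intro integral_has_vector_derivative_continuous_at) (auto intro: continuous_at_imp_continuous_within)
    then show ?thesis
      using t by (simp add: at_within_Icc_at)
  qed
  moreover have "((\<lambda>u. E (ln u)) has_vector_derivative (1 / t) *\<^sub>R (A ** E (ln t))) (at t)"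
    using vector_diff_chain_at[of ln "1 / t" t E "A ** E (ln t)"] t E_deriv
    by (simp add: o_def has_real_derivative_iff_has_vector_derivative[symmetric] DERIV_ln_divide)
  ultimately have "((\<lambda>u. E (ln u) *v G u) has_vector_derivative
      E (ln t) *v g t + ((1 / t) *\<^sub>R (A ** E (ln t))) *v G t) (at t)"
    by (rule mv.has_vector_derivative[rotated])
  moreover have "E (ln t) *v g t + ((1 / t) *\<^sub>R (A ** E (ln t))) *v G t = (1 / t) *\<^sub>R (b t + A *v conv b t)"
    using conv_G[OF t] kernel_g[of t t] t E_0
    by (simp add: flow_kernel_def mv.scaleR_left scaleR_add_right matrix_vector_mul_assoc)
  ultimately show ?thesis
    using t conv_G
    by (auto intro: has_vector_derivative_transform_within_open[of _ _ _ "{0<..}"])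
qed

lemma continuous_on_conv:
  assumes b: "admissible b"
  shows "continuous_on {0..} (conv b)"
proof -
  have "continuous (at t within {0..}) (conv b)" if "t \<ge> 0" for t
  proof (cases "t = 0")
    case False
    then show ?thesis
      using conv_has_vector_derivative[OF b, of t] that
      by (auto intro: continuous_at_imp_continuous_within has_vector_derivative_continuous)
  next
    case True
    define H where "H = (LINT s:{0..1}|lborel. s powr (- 1 - \<kappa>) * norm (b s))"
    have "((\<lambda>t. K * t powr \<kappa> * H) \<longlongrightarrow> K * 0 powr \<kappa> * H) (at 0 within {0..})"
      using lambda_pos by (intro tendsto_intros tendsto_powr2) (auto simp: eventually_at_topological)
    moreover have "\<forall>\<^sub>F t in at 0 within {0..}. norm (conv b t) \<le> K * t powr \<kappa> * H"
      unfolding eventually_at using norm_conv_le[OF b, of _ 1]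
      by (intro exI[of _ 1]) (auto simp: H_def dist_real_def)
    ultimately have "(conv b \<longlongrightarrow> 0) (at 0 within {0..})"
      using Lim_null_comparison[of "conv b"] by simp
    then show ?thesis using True by (simp add: continuous_within)
  qed
  then show ?thesis by (simp add: continuous_on_eq_continuous_within)
qed

text \<open>Away from \<open>0\<close> the claim integrates \<open>conv_has_vector_derivative\<close>. The singularity at \<open>0\<close> is harmless:
\<open>conv b\<close> is continuous there with value \<open>0\<close>, and \<open>norm (conv b s) / s\<close> is at most a multiple of
\<open>s powr (\<kappa> - 1)\<close>, which is integrable because \<open>\<kappa> > 0\<close>.\<close>

theorem conv_integral_equation:
  assumes b: "admissible b" and t: "0 \<le> t"
  shows "set_integrable lborel {0..t} (\<lambda>s. (1 / s) *\<^sub>R (b s + A *v conv b s))"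
    and "conv b t = (LINT s:{0..t}|lborel. (1 / s) *\<^sub>R (b s + A *v conv b s))"
proof -
  define H where "H = (LINT s:{0..t}|lborel. s powr (- 1 - \<kappa>) * norm (b s))"
  define w where "w s = t powr \<kappa> * (s powr (- 1 - \<kappa>) * norm (b s)) + norm A * K * H * s powr (\<kappa> - 1)" for s
  show int: "set_integrable lborel {0..t} (\<lambda>s. (1 / s) *\<^sub>R (b s + A *v conv b s))"
    unfolding set_integrable_def
  proof (rule Bochner_Integration.integrable_bound)
    show "integrable lborel (\<lambda>s. indicator {0..t} s *\<^sub>R w s)"
      unfolding w_def set_integrable_def[symmetric]
      using b t lambda_pos
      by (intro set_integral_add set_integrable_mult_right set_integrable_powr) (auto simp: admissible_def)
    have "continuous_on {0..t} (\<lambda>s. b s + A *v conv b s)"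
      using b continuous_on_conv[OF b]
      by (intro continuous_intros matrix_vector_mult_linear_continuous_on[THEN continuous_on_compose2])
        (auto simp: admissible_def elim: continuous_on_subset)
    then have "(\<lambda>s. indicator {0..t} s *\<^sub>R (b s + A *v conv b s)) \<in> borel_measurable lborel"
      by (simp add: borel_measurable_continuous_on_indicator)
    then have "(\<lambda>s. (1 / s) *\<^sub>R (indicator {0..t} s *\<^sub>R (b s + A *v conv b s))) \<in> borel_measurable lborel"
      by measurable
    then show "(\<lambda>s. indicator {0..t} s *\<^sub>R (1 / s) *\<^sub>R (b s + A *v conv b s)) \<in> borel_measurable lborel"
      by (simp add: scaleR_left_commute)
    (* The factor 1 / s in front of b is enlarged to (1 / s) (t / s)^\<kappa>, the weight of admissibility. *)
    have "norm ((1 / s) *\<^sub>R (b s + A *v conv b s)) \<le> w s" if s: "0 < s" "s \<le> t" for s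
    proof -
      have "norm ((1 / s) *\<^sub>R (b s + A *v conv b s)) \<le> (1 / s) * (norm (b s) + norm A * norm (conv b s))"
        using s norm_triangle_ineq[of "b s" "A *v conv b s"] norm_matrix_vector_mult_le[of A "conv b s"]
        by (simp add: divide_right_mono)
      also have "\<dots> \<le> (1 / s) * ((t / s) powr \<kappa> * norm (b s) + norm A * (K * s powr \<kappa> * H))"
        using s lambda_pos norm_conv_le[OF b, of s t] mult_right_mono[OF ge_one_powr_ge_zero[of "t / s" \<kappa>], of "norm (b s)"]
        unfolding H_def[symmetric]
        by (intro mult_left_mono add_mono) auto
      also have "\<dots> = w s"
        using s by (simp add: w_def powr_diff powr_minus powr_divide field_simps)
      finally show ?thesis .
    qed
    moreover have "AE s in lborel. s \<noteq> (0 :: real)"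
      by (rule AE_lborel_singleton)
    ultimately show "AE s in lborel. norm (indicator {0..t} s *\<^sub>R (1 / s) *\<^sub>R (b s + A *v conv b s))
        \<le> norm (indicator {0..t} s *\<^sub>R w s)"
      by (elim eventually_mono) (auto split: split_indicator intro: order.trans[OF _ abs_ge_self])
  qed
  have "((\<lambda>s. (1 / s) *\<^sub>R (b s + A *v conv b s)) has_integral conv b t - conv b 0) {0..t}"
    using t continuous_on_conv[OF b] conv_has_vector_derivative[OF b]
    by (intro fundamental_theorem_of_calculus_interior) (auto elim: continuous_on_subset)
  then show "conv b t = (LINT s:{0..t}|lborel. (1 / s) *\<^sub>R (b s + A *v conv b s))"
    using set_borel_integral_eq_integral(2)[OF int] by (simp add: integral_unique)
qed

end

section \<open>Partitions\<close>

lemma partition_of_le: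
  assumes "partition_of n \<tau> t" "i \<le> j" "j \<le> n"
  shows "\<tau> i \<le> \<tau> j"
  using assms(2,3)
proof (induction j rule: dec_induct)
  case (step k)
  then have "\<tau> i \<le> \<tau> k" "\<tau> k < \<tau> (Suc k)"
    using assms(1) by (auto simp: partition_of_def)
  then show ?case by simp
qed simp

lemma partition_of_bounds:
  assumes "partition_of n \<tau> t" "i \<le> n"
  shows "0 \<le> \<tau> i" "\<tau> i \<le> t"
  using partition_of_le[OF assms(1), of 0 i] partition_of_le[OF assms(1), of i n] assms
  by (auto simp: partition_of_def)

lemma partition_of_cell:
  assumes "partition_of n \<tau> t" "0 < s" "s \<le> t"
  obtains j where "j < n" "\<tau> j < s" "s \<le> \<tau> (Suc j)"
proof -
  define m where "m = (LEAST m. s \<le> \<tau> m)"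
  have ex: "s \<le> \<tau> n" using assms by (simp add: partition_of_def)
  have m: "s \<le> \<tau> m" "m \<le> n"
    unfolding m_def using LeastI[of "\<lambda>m. s \<le> \<tau> m", OF ex] Least_le[of "\<lambda>m. s \<le> \<tau> m", OF ex] by auto
  moreover have "m \<noteq> 0"
    using m(1) assms by (metis partition_of_def not_less)
  then obtain j where j: "m = Suc j" by (cases m) auto
  moreover have "\<not> s \<le> \<tau> j" using not_less_Least[of j "\<lambda>m. s \<le> \<tau> m"] j m_def by auto
  ultimately show ?thesis by (intro that[of j]) auto
qed

lemma partition_sum_eq:
  fixes c :: "nat \<Rightarrow> 'v :: real_vector"
  assumes "partition_of n \<tau> t" "j < n" "\<tau> j < s" "s \<le> \<tau> (Suc j)"
  shows "(\<Sum>i<n. indicator {\<tau> i<..\<tau> (Suc i)} s *\<^sub>R c i) = c j"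
proof -
  have "indicator {\<tau> i<..\<tau> (Suc i)} s *\<^sub>R c i = (if i = j then c j else 0)" if "i < n" for i
  proof (cases i j rule: linorder_cases)
    case less
    then have "\<tau> (Suc i) < s"
      using partition_of_le[OF assms(1), of "Suc i" j] assms by auto
    then show ?thesis using less by auto
  next
    case greater
    then have "s \<le> \<tau> i"
      using partition_of_le[OF assms(1), of "Suc j" i] assms that by auto
    then show ?thesis using greater by auto
  qed (use assms in auto)
  then show ?thesis using assms by simp
qed

section \<open>Second moments of Brownian increments\<close>

lemma brownian_increment_moment:
  assumes W: "standard_brownian_motion M W" and st: "0 \<le> s" "0 \<le> t"
  shows "has_bochner_integral M (\<lambda>\<omega>. (W t \<omega> - W s \<omega>)\<^sup>2) \<bar>t - s\<bar>"
proof -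
  have less: "has_bochner_integral M (\<lambda>\<omega>. (W t \<omega> - W s \<omega>)\<^sup>2) (t - s)" if "0 \<le> s" "s < t" for s t
  proof -
    interpret prob_space M using W by (simp add: standard_brownian_motion_def)
    have D: "distributed M lborel (\<lambda>\<omega>. W t \<omega> - W s \<omega>) (normal_density 0 (sqrt (t - s)))"
      using W that by (simp add: standard_brownian_motion_def)
    have "integrable M (\<lambda>\<omega>. (W t \<omega> - W s \<omega>)\<^sup>2)"
      using integrable_normal_moment[of "sqrt (t - s)" 0 2] that
      by (subst distributed_integrable[OF D, symmetric]) auto
    moreover have "(LINT \<omega>|M. (W t \<omega> - W s \<omega>)\<^sup>2) = t - s"
      using normal_distributed_variance[OF _ D] normal_distributed_expectation[OF _ D] that by simp
    ultimately show ?thesis by (simp add: has_bochner_integral_iff)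
  qed
  consider "s < t" | "s = t" | "t < s" by linarith
  then show ?thesis
  proof cases
    case 3
    then show ?thesis using less[of t s] st by (simp add: power2_commute)
  qed (use less st in auto)
qed

text \<open>Polarization: with \<open>x = W b\<close>, \<open>y = W a\<close>, \<open>z = W d\<close>, \<open>w = W c\<close>, the product \<open>(x - y) (z - w)\<close> is half of
\<open>(x - w)\<^sup>2 + (z - y)\<^sup>2 - (z - x)\<^sup>2 - (w - y)\<^sup>2\<close>, so the second moments of increments determine the
covariances, for intervals in any position. Hence two step functions can be compared without
passing to a common refinement of their partitions.\<close>

lemma brownian_increment_covariance:
  assumes W: "standard_brownian_motion M W" and "0 \<le> a" "a \<le> b" "0 \<le> c" "c \<le> d"
  shows "has_bochner_integral M (\<lambda>\<omega>. (W b \<omega> - W a \<omega>) * (W d \<omega> - W c \<omega>))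
    (measure lborel ({a<..b} \<inter> {c<..d}))"
proof -
  have m: "has_bochner_integral M (\<lambda>\<omega>. (W t \<omega> - W s \<omega>)\<^sup>2) \<bar>t - s\<bar>" if "0 \<le> s" "0 \<le> t" for s t
    by (rule brownian_increment_moment[OF W that])
  have "has_bochner_integral M (\<lambda>\<omega>. ((W b \<omega> - W c \<omega>)\<^sup>2 + (W d \<omega> - W a \<omega>)\<^sup>2
      - (W d \<omega> - W b \<omega>)\<^sup>2 - (W c \<omega> - W a \<omega>)\<^sup>2) / 2) ((\<bar>b - c\<bar> + \<bar>d - a\<bar> - \<bar>d - b\<bar> - \<bar>c - a\<bar>) / 2)"
    using assms by (intro has_bochner_integral_divide_zero has_bochner_integral_diff
      has_bochner_integral_add m) auto
  moreover have "((W b \<omega> - W c \<omega>)\<^sup>2 + (W d \<omega> - W a \<omega>)\<^sup>2 - (W d \<omega> - W b \<omega>)\<^sup>2 - (W c \<omega> - W a \<omega>)\<^sup>2) / 2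
      = (W b \<omega> - W a \<omega>) * (W d \<omega> - W c \<omega>)" for \<omega>
    by (simp add: power2_eq_square field_simps)
  moreover have "{a<..b} \<inter> {c<..d} = {max a c<..min b d}" by auto
  then have "measure lborel ({a<..b} \<inter> {c<..d}) = (\<bar>b - c\<bar> + \<bar>d - a\<bar> - \<bar>d - b\<bar> - \<bar>c - a\<bar>) / 2"
    using assms by (cases "max a c \<le> min b d") (auto simp: max_def min_def split: if_splits)
  ultimately show ?thesis by (simp only:)
qed

text \<open>Both sides are the same quadratic form in the coefficients, with the lengths of the
intersections as its matrix.\<close>

lemma brownian_isometry:
  fixes c a b :: "'i \<Rightarrow> real"
  assumes W: "standard_brownian_motion M W"
    and ab: "\<And>i. i \<in> I \<Longrightarrow> 0 \<le> a i \<and> a i \<le> b i"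
  obtains v where "has_bochner_integral M (\<lambda>\<omega>. (\<Sum>i\<in>I. c i * (W (b i) \<omega> - W (a i) \<omega>))\<^sup>2) v"
    and "has_bochner_integral lborel (\<lambda>s. (\<Sum>i\<in>I. c i * indicator {a i<..b i} s)\<^sup>2) v"
proof -
  have square: "(\<Sum>i\<in>I. c i * x i)\<^sup>2 = (\<Sum>i\<in>I. \<Sum>j\<in>I. (c i * c j) * (x i * x j))" for x :: "'i \<Rightarrow> real"
    by (simp add: power2_eq_square sum_product mult_ac)
  define v where "v = (\<Sum>i\<in>I. \<Sum>j\<in>I. (c i * c j) * measure lborel ({a i<..b i} \<inter> {a j<..b j}))"
  have "has_bochner_integral M (\<lambda>\<omega>. \<Sum>i\<in>I. \<Sum>j\<in>I. (c i * c j) *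
      ((W (b i) \<omega> - W (a i) \<omega>) * (W (b j) \<omega> - W (a j) \<omega>))) v"
    unfolding v_def using ab
    by (intro has_bochner_integral_sum has_bochner_integral_mult_right brownian_increment_covariance[OF W]) auto
  moreover have "has_bochner_integral lborel (\<lambda>s. \<Sum>i\<in>I. \<Sum>j\<in>I. (c i * c j) *
      indicator ({a i<..b i} \<inter> {a j<..b j}) s) v"
    unfolding v_def
  proof (intro has_bochner_integral_sum has_bochner_integral_mult_right has_bochner_integral_real_indicator)
    fix i j
    have "emeasure lborel ({a i<..b i} \<inter> {a j<..b j}) \<le> emeasure lborel {a i<..b i}"
      by (intro emeasure_mono) auto
    also have "\<dots> < \<infinity>" by (cases "a i \<le> b i") auto
    finally show "emeasure lborel ({a i<..b i} \<inter> {a j<..b j}) < \<infinity>" .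
  qed auto
  ultimately show ?thesis
    using that[of v] by (simp only: square indicator_inter_arith)
qed

lemma brownian_increment_norm_moment:
  fixes B :: "real \<Rightarrow> 'a \<Rightarrow> real ^ 'n"
  assumes B: "standard_brownian_motion_vec M B" and st: "0 \<le> s" "0 \<le> t"
  shows "(\<integral>\<^sup>+\<omega>. ennreal ((norm (B t \<omega> - B s \<omega>))\<^sup>2) \<partial>M) = ennreal (real CARD('n) * \<bar>t - s\<bar>)"
proof -
  have "has_bochner_integral M (\<lambda>\<omega>. \<Sum>j\<in>UNIV. (B t \<omega> $ j - B s \<omega> $ j)\<^sup>2) (\<Sum>j\<in>(UNIV :: 'n set). \<bar>t - s\<bar>)"
    using B st by (intro has_bochner_integral_sum brownian_increment_moment)
      (auto simp: standard_brownian_motion_vec_def)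
  then have "has_bochner_integral M (\<lambda>\<omega>. (norm (B t \<omega> - B s \<omega>))\<^sup>2) (real CARD('n) * \<bar>t - s\<bar>)"
    by (simp add: norm_vec_def L2_set_def sum_nonneg)
  then show ?thesis by (simp add: has_bochner_integral_iff nn_integral_eq_integral)
qed

lemma brownian_vec_measurable:
  fixes B :: "real \<Rightarrow> 'a \<Rightarrow> real ^ 'n"
  assumes "standard_brownian_motion_vec M B" "0 \<le> t"
  shows "B t \<in> borel_measurable M"
proof -
  have "(\<lambda>\<omega>. B t \<omega> \<bullet> axis j 1) \<in> borel_measurable M" for j
    using assms by (simp add: standard_brownian_motion_vec_def standard_brownian_motion_def inner_axis)
  then show ?thesis
    by (subst borel_measurable_euclidean_space) (auto simp: Basis_vec_def)
qed

section \<open>The isometry inequality and uniqueness of the integral\<close>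

text \<open>The entries of the integral are sums over the coordinates \<open>j\<close> of scalar integrals;
\<open>(\<Sum>j. y\<^sub>j)\<^sup>2 \<le> CARD('n) * (\<Sum>j. y\<^sub>j\<^sup>2)\<close> reduces the estimate to the scalar isometry, at the price of a
constant factor.\<close>

lemma brownian_isometry_vec_le:
  fixes B :: "real \<Rightarrow> 'a \<Rightarrow> real ^ 'n" and c :: "'i \<Rightarrow> real ^ 'n ^ 'm"
  assumes B: "standard_brownian_motion_vec M B"
    and ab: "\<And>i. i \<in> I \<Longrightarrow> 0 \<le> a i \<and> a i \<le> b i"
  shows "(\<integral>\<^sup>+\<omega>. ennreal ((norm (\<Sum>i\<in>I. c i *v (B (b i) \<omega> - B (a i) \<omega>)))\<^sup>2) \<partial>M)
    \<le> real CARD('n) * (\<integral>\<^sup>+s. ennreal ((norm (\<Sum>i\<in>I. indicator {a i<..b i} s *\<^sub>R c i))\<^sup>2) \<partial>lborel)"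
proof -
  define y where "y m j \<omega> = (\<Sum>i\<in>I. c i $ m $ j * (B (b i) \<omega> $ j - B (a i) \<omega> $ j))" for m j \<omega>
  define f where "f m j s = (\<Sum>i\<in>I. c i $ m $ j * indicator {a i<..b i} s)" for m j s
  have "\<exists>v. has_bochner_integral M (\<lambda>\<omega>. (y m j \<omega>)\<^sup>2) v \<and> has_bochner_integral lborel (\<lambda>s. (f m j s)\<^sup>2) v" for m j
    unfolding y_def f_def
    by (rule brownian_isometry[of M "\<lambda>t \<omega>. B t \<omega> $ j" I a b "\<lambda>i. c i $ m $ j"])
      (use B ab in \<open>auto simp: standard_brownian_motion_vec_def\<close>)
  then obtain v where v: "\<And>m j. has_bochner_integral M (\<lambda>\<omega>. (y m j \<omega>)\<^sup>2) (v m j)"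
      "\<And>m j. has_bochner_integral lborel (\<lambda>s. (f m j s)\<^sup>2) (v m j)"
    by metis
  have le: "(norm (\<Sum>i\<in>I. c i *v (B (b i) \<omega> - B (a i) \<omega>)))\<^sup>2 \<le> real CARD('n) * (\<Sum>m\<in>UNIV. \<Sum>j\<in>UNIV. (y m j \<omega>)\<^sup>2)" for \<omega>
  proof -
    have "(\<Sum>i\<in>I. c i *v (B (b i) \<omega> - B (a i) \<omega>)) $ m = (\<Sum>j\<in>UNIV. y m j \<omega>)" for m
      unfolding y_def by (subst sum.swap) (simp add: matrix_vector_mult_def)
    then have "(norm (\<Sum>i\<in>I. c i *v (B (b i) \<omega> - B (a i) \<omega>)))\<^sup>2 = (\<Sum>m\<in>UNIV. (\<Sum>j\<in>UNIV. y m j \<omega>)\<^sup>2)"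
      by (simp add: norm_vec_def L2_set_def sum_nonneg)
    also have "\<dots> \<le> (\<Sum>m\<in>UNIV. real CARD('n) * (\<Sum>j\<in>UNIV. (y m j \<omega>)\<^sup>2))"
    proof (rule sum_mono)
      fix m
      show "(\<Sum>j\<in>UNIV. y m j \<omega>)\<^sup>2 \<le> real CARD('n) * (\<Sum>j\<in>UNIV. (y m j \<omega>)\<^sup>2)"
        using Cauchy_Schwarz_ineq_sum[of "\<lambda>_. 1" "\<lambda>j. y m j \<omega>" UNIV] by simp
    qed
    finally show ?thesis by (simp add: sum_distrib_left)
  qed
  have eq: "(norm (\<Sum>i\<in>I. indicator {a i<..b i} s *\<^sub>R c i))\<^sup>2 = (\<Sum>m\<in>UNIV. \<Sum>j\<in>UNIV. (f m j s)\<^sup>2)" for s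
    by (simp add: f_def norm_vec_def L2_set_def sum_nonneg mult.commute)
  have sums: "has_bochner_integral M (\<lambda>\<omega>. \<Sum>m\<in>UNIV. \<Sum>j\<in>UNIV. (y m j \<omega>)\<^sup>2) (\<Sum>m\<in>UNIV. \<Sum>j\<in>UNIV. v m j)"
      "has_bochner_integral lborel (\<lambda>s. \<Sum>m\<in>UNIV. \<Sum>j\<in>UNIV. (f m j s)\<^sup>2) (\<Sum>m\<in>UNIV. \<Sum>j\<in>UNIV. v m j)"
    by (intro has_bochner_integral_sum v)+
  have "(\<integral>\<^sup>+\<omega>. ennreal ((norm (\<Sum>i\<in>I. c i *v (B (b i) \<omega> - B (a i) \<omega>)))\<^sup>2) \<partial>M)
      \<le> (\<integral>\<^sup>+\<omega>. ennreal (real CARD('n) * (\<Sum>m\<in>UNIV. \<Sum>j\<in>UNIV. (y m j \<omega>)\<^sup>2)) \<partial>M)"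
    by (intro nn_integral_mono ennreal_leI le)
  also have "\<dots> = real CARD('n) * (\<integral>\<^sup>+\<omega>. ennreal (\<Sum>m\<in>UNIV. \<Sum>j\<in>UNIV. (y m j \<omega>)\<^sup>2) \<partial>M)"
    using sums(1) by (subst nn_integral_cmult[symmetric]) (auto simp: ennreal_mult' has_bochner_integral_iff)
  also have "(\<integral>\<^sup>+\<omega>. ennreal (\<Sum>m\<in>UNIV. \<Sum>j\<in>UNIV. (y m j \<omega>)\<^sup>2) \<partial>M)
      = (\<integral>\<^sup>+s. ennreal (\<Sum>m\<in>UNIV. \<Sum>j\<in>UNIV. (f m j s)\<^sup>2) \<partial>lborel)"
    using sums by (simp add: nn_integral_eq_integral has_bochner_integral_iff sum_nonneg)
  finally show ?thesis by (simp add: eq)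
qed

lemma step_fun_outside:
  assumes "partition_of n \<tau> t" "s \<notin> {0..t}"
  shows "step_fun n \<tau> c s = 0"
  unfolding step_fun_def
proof (intro sum.neutral ballI)
  fix i assume "i \<in> {..<n}"
  then have "0 \<le> \<tau> i" "\<tau> (Suc i) \<le> t"
    using partition_of_bounds[OF assms(1)] by auto
  then show "indicator {\<tau> i<..\<tau> (Suc i)} s *\<^sub>R c i = 0"
    using assms(2) by (auto split: split_indicator)
qed

text \<open>A difference of two step integrals is a single sum over the disjoint union of the
two families of intervals.\<close>

lemma step_integral_diff_le:
  fixes B :: "real \<Rightarrow> 'a \<Rightarrow> real ^ 'n" and c d :: "nat \<Rightarrow> real ^ 'n ^ 'm"
  assumes B: "standard_brownian_motion_vec M B"
    and \<tau>: "partition_of n \<tau> t" and \<sigma>: "partition_of m \<sigma> t"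
  shows "(\<integral>\<^sup>+\<omega>. ennreal ((norm (step_integral B n \<tau> c \<omega> - step_integral B m \<sigma> d \<omega>))\<^sup>2) \<partial>M)
    \<le> real CARD('n) * (\<integral>\<^sup>+s\<in>{0..t}. ennreal ((norm (step_fun n \<tau> c s - step_fun m \<sigma> d s))\<^sup>2) \<partial>lborel)"
proof -
  define I where "I = {..<n} <+> {..<m}"
  define a where "a = case_sum \<tau> \<sigma>"
  define b where "b = case_sum (\<lambda>i. \<tau> (Suc i)) (\<lambda>i. \<sigma> (Suc i))"
  define e where "e = case_sum c (\<lambda>i. - d i)"
  have "0 \<le> a i \<and> a i \<le> b i" if "i \<in> I" for i
    using that partition_of_bounds[OF \<tau>] partition_of_bounds[OF \<sigma>]
      partition_of_le[OF \<tau>] partition_of_le[OF \<sigma>]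
    by (auto simp: I_def a_def b_def)
  note le = brownian_isometry_vec_le[of M B I a b e, OF B this]
  interpret mv: bounded_bilinear "(*v) :: real ^ 'n ^ 'm \<Rightarrow> real ^ 'n \<Rightarrow> real ^ 'm"
    by (rule bounded_bilinear_matrix_vector_mult)
  have "(\<Sum>i\<in>I. e i *v (B (b i) \<omega> - B (a i) \<omega>)) = step_integral B n \<tau> c \<omega> - step_integral B m \<sigma> d \<omega>" for \<omega>
    unfolding I_def by (subst sum.Plus) (simp_all add: a_def b_def e_def step_integral_def mv.minus_left sum_negf)
  moreover have step: "(\<Sum>i\<in>I. indicator {a i<..b i} s *\<^sub>R e i) = step_fun n \<tau> c s - step_fun m \<sigma> d s" for s
    unfolding I_def by (subst sum.Plus) (simp_all add: a_def b_def e_def step_fun_def sum_negf)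
  moreover have "(\<integral>\<^sup>+s\<in>{0..t}. ennreal ((norm (step_fun n \<tau> c s - step_fun m \<sigma> d s))\<^sup>2) \<partial>lborel)
      = (\<integral>\<^sup>+s. ennreal ((norm (step_fun n \<tau> c s - step_fun m \<sigma> d s))\<^sup>2) \<partial>lborel)"
    by (intro nn_integral_cong) (auto simp: step_fun_outside[OF \<tau>] step_fun_outside[OF \<sigma>] split: split_indicator)
  ultimately show ?thesis using le by simp
qed

lemma norm_add3_squared_le:
  fixes x y z :: "'v :: real_normed_vector"
  shows "(norm (x + y + z))\<^sup>2 \<le> 3 * (norm x)\<^sup>2 + 3 * (norm y)\<^sup>2 + 3 * (norm z)\<^sup>2"
proof -
  have "(norm (x + y + z))\<^sup>2 \<le> (norm x + norm y + norm z)\<^sup>2"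
    by (intro power_mono order.trans[OF norm_triangle_ineq] add_mono order.refl) (auto intro: norm_triangle_ineq)
  also have "\<dots> \<le> 3 * (norm x)\<^sup>2 + 3 * (norm y)\<^sup>2 + 3 * (norm z)\<^sup>2"
    using zero_le_power2[of "norm x - norm y"] zero_le_power2[of "norm x - norm z"] zero_le_power2[of "norm y - norm z"]
    by (simp add: power2_eq_square algebra_simps)
  finally show ?thesis .
qed

lemma nn_integral_norm_squared_triangle:
  fixes x y z w :: "'a \<Rightarrow> 'v :: euclidean_space"
  assumes [measurable]: "x \<in> borel_measurable M" "y \<in> borel_measurable M" "z \<in> borel_measurable M" "w \<in> borel_measurable M"
  shows "(\<integral>\<^sup>+\<omega>. ennreal ((norm (x \<omega> - w \<omega>))\<^sup>2) \<partial>M) \<le>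
    3 * (\<integral>\<^sup>+\<omega>. ennreal ((norm (x \<omega> - y \<omega>))\<^sup>2) \<partial>M) +
    3 * (\<integral>\<^sup>+\<omega>. ennreal ((norm (y \<omega> - z \<omega>))\<^sup>2) \<partial>M) +
    3 * (\<integral>\<^sup>+\<omega>. ennreal ((norm (z \<omega> - w \<omega>))\<^sup>2) \<partial>M)"
proof -
  have "ennreal ((norm (x \<omega> - w \<omega>))\<^sup>2) \<le> 3 * ennreal ((norm (x \<omega> - y \<omega>))\<^sup>2) +
      3 * ennreal ((norm (y \<omega> - z \<omega>))\<^sup>2) + 3 * ennreal ((norm (z \<omega> - w \<omega>))\<^sup>2)" for \<omega>
  proof -
    have "(norm (x \<omega> - w \<omega>))\<^sup>2 \<le> 3 * (norm (x \<omega> - y \<omega>))\<^sup>2 + 3 * (norm (y \<omega> - z \<omega>))\<^sup>2 + 3 * (norm (z \<omega> - w \<omega>))\<^sup>2"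
      using norm_add3_squared_le[of "x \<omega> - y \<omega>" "y \<omega> - z \<omega>" "z \<omega> - w \<omega>"] by simp
    then show ?thesis
      by (simp add: ennreal_mult'[symmetric] flip: ennreal_plus ennreal_numeral)
  qed
  then have "(\<integral>\<^sup>+\<omega>. ennreal ((norm (x \<omega> - w \<omega>))\<^sup>2) \<partial>M) \<le> (\<integral>\<^sup>+\<omega>. 3 * ennreal ((norm (x \<omega> - y \<omega>))\<^sup>2) +
      3 * ennreal ((norm (y \<omega> - z \<omega>))\<^sup>2) + 3 * ennreal ((norm (z \<omega> - w \<omega>))\<^sup>2) \<partial>M)"
    by (rule nn_integral_mono)
  then show ?thesis
    by (simp add: nn_integral_add nn_integral_cmult)
qed

lemma step_fun_measurable: "step_fun n \<tau> c \<in> borel_measurable borel"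
  unfolding step_fun_def[abs_def] by measurable

lemma step_integral_measurable:
  fixes B :: "real \<Rightarrow> 'a \<Rightarrow> real ^ 'n" and c :: "nat \<Rightarrow> real ^ 'n ^ 'm"
  assumes "\<And>t. 0 \<le> t \<Longrightarrow> B t \<in> borel_measurable M" "partition_of n \<tau> t"
  shows "step_integral B n \<tau> c \<in> borel_measurable M"
  unfolding step_integral_def[abs_def]
  using assms(1) partition_of_bounds(1)[OF assms(2)]
  by (intro borel_measurable_sum borel_measurable_matrix_vector_mult borel_measurable_diff) auto

text \<open>If two sequences of step functions both converge to \<open>f\<close>, their difference tends to \<open>0\<close> in \<open>L\<^sup>2[0, t]\<close>, hence
so does the difference of their integrals in \<open>L\<^sup>2(M)\<close>, by \<open>step_integral_diff_le\<close>.\<close>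

lemma has_wiener_integral_unique:
  fixes B :: "real \<Rightarrow> 'a \<Rightarrow> real ^ 'n" and f :: "real \<Rightarrow> real ^ 'n ^ 'm"
  assumes B: "standard_brownian_motion_vec M B"
    and X: "has_wiener_integral M B t f X" and Y: "has_wiener_integral M B t f Y"
  shows "AE \<omega> in M. X \<omega> = Y \<omega>"
proof -
  define L where "L x y = (\<integral>\<^sup>+\<omega>. ennreal ((norm (x \<omega> - y \<omega> :: real ^ 'm))\<^sup>2) \<partial>M)" for x y :: "'a \<Rightarrow> real ^ 'm"
  define T where "T g h = (\<integral>\<^sup>+s\<in>{0..t}. ennreal ((norm (g s - h s :: real ^ 'n ^ 'm))\<^sup>2) \<partial>lborel)" for g h :: "real \<Rightarrow> real ^ 'n ^ 'm"
  have meas: "X \<in> borel_measurable M" "Y \<in> borel_measurable M"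
    using X Y by (auto simp: has_wiener_integral_def)
  have f: "(\<lambda>s. indicator {0..t} s *\<^sub>R f s) \<in> borel_measurable lborel"
    using X by (simp add: has_wiener_integral_def set_borel_measurable_def)
  obtain n \<tau> c where 1: "\<And>k. partition_of (n k) (\<tau> k) t"
      "(\<lambda>k. T (step_fun (n k) (\<tau> k) (c k)) f) \<longlonglongrightarrow> 0"
      "(\<lambda>k. L (step_integral B (n k) (\<tau> k) (c k)) X) \<longlonglongrightarrow> 0"
    using X unfolding has_wiener_integral_def L_def T_def by blast
  obtain m \<sigma> d where 2: "\<And>k. partition_of (m k) (\<sigma> k) t"
      "(\<lambda>k. T (step_fun (m k) (\<sigma> k) (d k)) f) \<longlonglongrightarrow> 0"
      "(\<lambda>k. L (step_integral B (m k) (\<sigma> k) (d k)) Y) \<longlonglongrightarrow> 0"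
    using Y unfolding has_wiener_integral_def L_def T_def by blast
  have L_sym: "L x y = L y x" for x y
    by (simp add: L_def norm_minus_commute)
  have T_sym: "T x y = T y x" for x y
    by (simp add: T_def norm_minus_commute)
  have T_le: "T (step_fun n \<tau> c) (step_fun m \<sigma> d) \<le>
      3 * T (step_fun n \<tau> c) f + 3 * T (step_fun m \<sigma> d) f" for n \<tau> c m \<sigma> d
  proof -
    have T_eq: "T g h = (\<integral>\<^sup>+s. ennreal ((norm (indicator {0..t} s *\<^sub>R g s - indicator {0..t} s *\<^sub>R h s))\<^sup>2) \<partial>lborel)" for g h
      unfolding T_def by (intro nn_integral_cong) (auto split: split_indicator)
    have "T f f = 0" by (simp add: T_def)
    have step: "(\<lambda>s. indicator {0..t} s *\<^sub>R step_fun n \<tau> c s) \<in> borel_measurable lborel" for n \<tau> and c :: "nat \<Rightarrow> real ^ 'n ^ 'm"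
      using step_fun_measurable[of n \<tau> c] by measurable
    have "T (step_fun n \<tau> c) (step_fun m \<sigma> d) \<le> 3 * T (step_fun n \<tau> c) f + 3 * T f f + 3 * T f (step_fun m \<sigma> d)"
      unfolding T_eq by (intro nn_integral_norm_squared_triangle step f)
    then show ?thesis using \<open>T f f = 0\<close> T_sym by simp
  qed
  have le: "L X Y \<le> 3 * L (step_integral B (n k) (\<tau> k) (c k)) X +
      3 * (real CARD('n) * (3 * T (step_fun (n k) (\<tau> k) (c k)) f + 3 * T (step_fun (m k) (\<sigma> k) (d k)) f)) +
      3 * L (step_integral B (m k) (\<sigma> k) (d k)) Y" (is "_ \<le> ?u k") for k
  proof -
    have "L (step_integral B (n k) (\<tau> k) (c k)) (step_integral B (m k) (\<sigma> k) (d k)) \<le>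
        real CARD('n) * T (step_fun (n k) (\<tau> k) (c k)) (step_fun (m k) (\<sigma> k) (d k))"
      unfolding L_def T_def by (rule step_integral_diff_le[OF B 1(1) 2(1)])
    also have "\<dots> \<le> real CARD('n) * (3 * T (step_fun (n k) (\<tau> k) (c k)) f + 3 * T (step_fun (m k) (\<sigma> k) (d k)) f)"
      by (intro mult_left_mono T_le) auto
    finally have mid: "L (step_integral B (n k) (\<tau> k) (c k)) (step_integral B (m k) (\<sigma> k) (d k)) \<le> \<dots>" .
    have "L X Y \<le> 3 * L X (step_integral B (n k) (\<tau> k) (c k)) +
        3 * L (step_integral B (n k) (\<tau> k) (c k)) (step_integral B (m k) (\<sigma> k) (d k)) +
        3 * L (step_integral B (m k) (\<sigma> k) (d k)) Y"
      unfolding L_def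
      by (intro nn_integral_norm_squared_triangle meas step_integral_measurable[OF _ 1(1)]
          step_integral_measurable[OF _ 2(1)] brownian_vec_measurable[OF B])
    also have "\<dots> \<le> ?u k"
      using mid by (intro add_mono mult_left_mono) (auto simp: L_sym)
    finally show ?thesis .
  qed
  have "?u \<longlonglongrightarrow> 3 * 0 + 3 * (ennreal (real CARD('n)) * (3 * 0 + 3 * 0)) + 3 * 0"
    by (intro tendsto_add ennreal_tendsto_cmult 1 2) auto
  then have "L X Y \<le> 0"
    using le by (intro LIMSEQ_le_const[of ?u 0]) auto
  then show ?thesis
    using meas by (simp add: L_def nn_integral_0_iff_AE)
qed

section \<open>Processes with continuous paths\<close>

lemma floor_grid_tendsto:
  assumes "0 \<le> s"
  shows "(\<lambda>k. real (nat \<lfloor>s * real (Suc k)\<rfloor>) / real (Suc k)) \<longlonglongrightarrow> s"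
proof (rule tendsto_sandwich)
  have b: "s - 1 / real (Suc k) \<le> real (nat \<lfloor>s * real (Suc k)\<rfloor>) / real (Suc k) \<and>
      real (nat \<lfloor>s * real (Suc k)\<rfloor>) / real (Suc k) \<le> s" for k
  proof -
    have "real (nat \<lfloor>s * real (Suc k)\<rfloor>) = of_int \<lfloor>s * real (Suc k)\<rfloor>"
      using assms by (simp del: of_nat_Suc)
    moreover have "s * real (Suc k) - 1 \<le> of_int \<lfloor>s * real (Suc k)\<rfloor>" "of_int \<lfloor>s * real (Suc k)\<rfloor> \<le> s * real (Suc k)"
      by linarith+
    moreover have "s - 1 / real (Suc k) = (s * real (Suc k) - 1) / real (Suc k)"
      by (simp add: diff_divide_distrib del: of_nat_Suc)
    ultimately show ?thesis by (simp add: divide_right_mono pos_divide_le_eq del: of_nat_Suc)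
  qed
  show "\<forall>\<^sub>F k in sequentially. s - 1 / real (Suc k) \<le> real (nat \<lfloor>s * real (Suc k)\<rfloor>) / real (Suc k)"
    and "\<forall>\<^sub>F k in sequentially. real (nat \<lfloor>s * real (Suc k)\<rfloor>) / real (Suc k) \<le> s"
    using b by auto
  show "(\<lambda>k. s - 1 / real (Suc k)) \<longlonglongrightarrow> s"
    using tendsto_diff[OF tendsto_const lim_1_over_n[THEN LIMSEQ_Suc], of s] by simp
qed auto

text \<open>The process is the pointwise limit of its values at the grid points to the left, and each of these
approximations is pieced together from countably many random variables. Joint measurability is what
allows the order of integration in time and expectation to be exchanged.\<close>

lemma continuous_process_measurable_pair:
  fixes X :: "real \<Rightarrow> 'a \<Rightarrow> 'b :: euclidean_space"
  assumes meas: "\<And>t. 0 \<le> t \<Longrightarrow> X t \<in> borel_measurable M"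
    and cont: "\<And>\<omega>. \<omega> \<in> space M \<Longrightarrow> continuous_on {0..} (\<lambda>t. X t \<omega>)"
  shows "(\<lambda>(s, \<omega>). indicator {0..} s *\<^sub>R X s \<omega>) \<in> borel_measurable (lborel \<Otimes>\<^sub>M M)"
proof -
  define Y where "Y k i = (\<lambda>p :: real \<times> 'a. X (real i / real (Suc k)) (snd p))" for k i :: nat
  define g where "g k = (\<lambda>p :: real \<times> 'a. nat \<lfloor>fst p * real (Suc k)\<rfloor>)" for k :: nat
  define U where "U k p = indicator {0..} (fst p) *\<^sub>R Y k (g k p) p" for k p
  have "U k \<in> borel_measurable (lborel \<Otimes>\<^sub>M M)" for k
  proof -
    have [measurable]: "Y k i \<in> borel_measurable (lborel \<Otimes>\<^sub>M M)" for i
      unfolding Y_def using meas[of "real i / real (Suc k)"] by measurable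
    have [measurable]: "g k \<in> measurable (lborel \<Otimes>\<^sub>M M) (count_space UNIV)"
      unfolding g_def by measurable
    have "(\<lambda>p. Y k (g k p) p) \<in> borel_measurable (lborel \<Otimes>\<^sub>M M)"
      by (rule measurable_compose_countable) measurable
    then show ?thesis
      unfolding U_def by measurable
  qed
  moreover have "(\<lambda>k. U k p) \<longlonglongrightarrow> (case p of (s, \<omega>) \<Rightarrow> indicator {0..} s *\<^sub>R X s \<omega>)"
    if "p \<in> space (lborel \<Otimes>\<^sub>M M)" for p
  proof -
    obtain s \<omega> where p: "p = (s, \<omega>)" "\<omega> \<in> space M"
      using \<open>p \<in> space (lborel \<Otimes>\<^sub>M M)\<close> by (auto simp: space_pair_measure)
    show ?thesis
    proof (cases "0 \<le> s")
      case True
      from floor_grid_tendsto[OF this] have "(\<lambda>k. X (real (nat \<lfloor>s * real (Suc k)\<rfloor>) / real (Suc k)) \<omega>) \<longlonglongrightarrow> X s \<omega>"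
        by (rule continuous_on_tendsto_compose[OF cont[OF p(2)]]) (use True in auto)
      then show ?thesis using True by (simp add: p U_def Y_def g_def)
    qed (simp add: p U_def)
  qed
  ultimately show ?thesis
    by (rule borel_measurable_LIMSEQ_metric)
qed

text \<open>A property of paths that holds almost surely, and holds for the zero path, can be
assumed to hold for all paths, after replacing the path by zero on a null set.\<close>

lemma AE_version:
  fixes X :: "real \<Rightarrow> 'a \<Rightarrow> 'b :: euclidean_space"
  assumes "AE \<omega> in M. P (\<lambda>t. X t \<omega>)" "P (\<lambda>_. 0)"
    and meas: "\<And>t. 0 \<le> t \<Longrightarrow> X t \<in> borel_measurable M"
  obtains Y where "\<And>t. 0 \<le> t \<Longrightarrow> Y t \<in> borel_measurable M"
    and "\<And>\<omega>. \<omega> \<in> space M \<Longrightarrow> P (\<lambda>t. Y t \<omega>)"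
    and "AE \<omega> in M. \<forall>t. Y t \<omega> = X t \<omega>"
proof -
  obtain N where N: "{\<omega>\<in>space M. \<not> P (\<lambda>t. X t \<omega>)} \<subseteq> N" "emeasure M N = 0" "N \<in> sets M"
    using assms(1) by (rule AE_E)
  define Y where "Y t \<omega> = (if \<omega> \<in> N then 0 else X t \<omega>)" for t \<omega>
  show ?thesis
  proof (rule that)
    show "Y t \<in> borel_measurable M" if "0 \<le> t" for t
      unfolding Y_def using meas[OF that] N(3) by (intro measurable_If_set) auto
    show "P (\<lambda>t. Y t \<omega>)" if "\<omega> \<in> space M" for \<omega>
      using that N(1) assms(2) by (cases "\<omega> \<in> N") (auto simp: Y_def)
    have "AE \<omega> in M. \<omega> \<notin> N"
      using N by (intro AE_not_in) (auto simp: null_sets_def)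
    then show "AE \<omega> in M. \<forall>t. Y t \<omega> = X t \<omega>"
      by eventually_elim (simp add: Y_def)
  qed
qed

text \<open>The countably many points \<open>i / (k + 1)\<close> are dense in \<open>[0, \<infinity>)\<close> and share one exceptional null set.\<close>

lemma AE_eq_processes:
  fixes X Y :: "real \<Rightarrow> 'a \<Rightarrow> 'b :: euclidean_space"
  assumes eq: "\<And>t. 0 \<le> t \<Longrightarrow> AE \<omega> in M. X t \<omega> = Y t \<omega>"
    and cont: "\<And>\<omega>. \<omega> \<in> space M \<Longrightarrow> continuous_on {0..} (\<lambda>t. X t \<omega>)"
      "\<And>\<omega>. \<omega> \<in> space M \<Longrightarrow> continuous_on {0..} (\<lambda>t. Y t \<omega>)"
  shows "AE \<omega> in M. \<forall>t\<ge>0. X t \<omega> = Y t \<omega>"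
proof -
  have "AE \<omega> in M. \<forall>k i. X (real i / real (Suc k)) \<omega> = Y (real i / real (Suc k)) \<omega>"
    unfolding AE_all_countable by (intro allI eq) simp
  then show ?thesis
    using AE_space
  proof eventually_elim
    case (elim \<omega>)
    show ?case
    proof (intro allI impI)
      fix t :: real assume t: "0 \<le> t"
      have lim: "(\<lambda>k. U (real (nat \<lfloor>t * real (Suc k)\<rfloor>) / real (Suc k))) \<longlonglongrightarrow> U t"
        if "continuous_on {0..} U" for U :: "real \<Rightarrow> 'b"
        by (rule continuous_on_tendsto_compose[OF that floor_grid_tendsto[OF t]]) (use t in auto)
      show "X t \<omega> = Y t \<omega>"
        using lim[OF cont(1)[OF elim(2)]] lim[OF cont(2)[OF elim(2)]] elim(1)
        by (auto intro: LIMSEQ_unique)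
    qed
  qed
qed

section \<open>Step functions approximate the flow, and their integrals its path formula\<close>

lemma uniform_partition:
  assumes "0 < t"
  shows "partition_of (Suc k) (\<lambda>i. real i * t / real (Suc k)) t"
  using assms by (auto simp: partition_of_def divide_strict_right_mono simp del: of_nat_Suc)

lemma uniform_partition_step:
  "real (Suc i) * t / N - real i * t / N = t / N"
  by (simp flip: diff_divide_distrib left_diff_distrib)

context subcritical_flow
begin

text \<open>\<open>A ** flow_kernel t s\<close> is minus the derivative of \<open>E (ln (t / s))\<close> with respect to \<open>s\<close>.\<close>

lemma kernel_integral_Ioc:
  assumes "0 < u" "u \<le> v" "v \<le> t"
  shows "integrable lborel (\<lambda>s. indicator {u<..v} s *\<^sub>R (flow_kernel t s *v x))" (is "integrable _ ?f")
    and "A *v (LINT s|lborel. indicator {u<..v} s *\<^sub>R (flow_kernel t s *v x))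
      = E (ln (t / u)) *v x - E (ln (t / v)) *v x"
proof -
  interpret mv: bounded_bilinear "(*v) :: real ^ 'n ^ 'n \<Rightarrow> real ^ 'n \<Rightarrow> real ^ 'n"
    by (rule bounded_bilinear_matrix_vector_mult)
  have "continuous_on {u..v} (\<lambda>s. flow_kernel t s *v x)"
    unfolding flow_kernel_def using assms by (intro mv.continuous_on continuous_intros) auto
  then have int: "set_integrable lborel {u..v} (\<lambda>s. flow_kernel t s *v x)"
    by (rule borel_integrable_atLeastAtMost')
  have "set_integrable lborel {u<..v} (\<lambda>s. flow_kernel t s *v x)"
    by (rule set_integrable_subset[OF int]) auto
  then show int': "integrable lborel ?f" by (simp add: set_integrable_def)
  have "((\<lambda>s. - (E (ln (t / s)) *v x)) has_vector_derivative A *v (flow_kernel t s *v x)) (at s)"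
    if "s \<in> {u..v}" for s
  proof -
    have s: "0 < s" "s \<le> t" using that assms by auto
    have "((\<lambda>s. ln (t / s)) has_real_derivative - (1 / s)) (at s)"
      using s by (auto intro!: derivative_eq_intros simp: field_simps power2_eq_square)
    then have "((\<lambda>s. E (ln (t / s))) has_vector_derivative - (1 / s) *\<^sub>R (A ** E (ln (t / s)))) (at s)"
      using vector_diff_chain_at[of "\<lambda>s. ln (t / s)" "- (1 / s)" s E] E_deriv
      by (simp add: o_def has_real_derivative_iff_has_vector_derivative)
    from has_vector_derivative_minus[OF bounded_linear.has_vector_derivative[OF mv.bounded_linear_left[of x] this]]
    show ?thesis
      by (simp add: flow_kernel_def mv.minus_left mv.scaleR_left mv.scaleR_right matrix_vector_mul_assoc)
  qed
  then have "((\<lambda>s. A *v (flow_kernel t s *v x)) has_integral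
      - (E (ln (t / v)) *v x) - - (E (ln (t / u)) *v x)) {u..v}"
    using assms by (intro fundamental_theorem_of_calculus) (auto intro: has_vector_derivative_at_within)
  moreover have "(LINT s|lborel. ?f s) = integral {u..v} (\<lambda>s. flow_kernel t s *v x)"
  proof -
    have "(LINT s|lborel. ?f s) = (LINT s|lborel. indicator {u..v} s *\<^sub>R (flow_kernel t s *v x))"
    proof (rule integral_cong_AE)
      have "AE s in lborel. s \<noteq> u" by (rule AE_lborel_singleton)
      then show "AE s in lborel. ?f s = indicator {u..v} s *\<^sub>R (flow_kernel t s *v x)"
        by eventually_elim (auto split: split_indicator)
    qed (use int int' in \<open>auto simp: set_integrable_def\<close>)
    then show ?thesis
      using set_borel_integral_eq_integral(2)[OF int] by (simp add: set_lebesgue_integral_def)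
  qed
  moreover have "integral {u..v} (\<lambda>s. A *v (flow_kernel t s *v x)) = A *v integral {u..v} (\<lambda>s. flow_kernel t s *v x)"
    using integral_linear[OF set_borel_integral_eq_integral(1)[OF int] mv.bounded_linear_right[of A]]
    by (simp add: o_def)
  ultimately show "A *v (LINT s|lborel. ?f s) = E (ln (t / u)) *v x - E (ln (t / v)) *v x"
    by (simp add: integral_unique)
qed

text \<open>Abel summation turns the Riemann-Stieltjes sum, with the flow at the right endpoints, into
\<open>b t\<close> plus \<open>\<Sum>i. (E (ln (t / \<tau> i)) - E (ln (t / \<tau> (Suc i)))) *v b (\<tau> i)\<close>, and \<open>kernel_integral_Ioc\<close> makes this
sum an integral of the kernel against the path frozen at the left endpoints. The first cell,
where the kernel need not be integrable, contributes nothing because \<open>b 0 = 0\<close>.\<close>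

lemma step_sum_by_parts:
  assumes b: "admissible b" and t: "0 < t" and \<tau>: "partition_of n \<tau> t"
  defines "\<beta> \<equiv> \<lambda>s. \<Sum>i<n. indicator {\<tau> i<..\<tau> (Suc i)} s *\<^sub>R b (\<tau> i)"
  shows "set_integrable lborel {0..t} (\<lambda>s. flow_kernel t s *v (\<beta> s - b s))"
    and "(\<Sum>i<n. E (ln (t / \<tau> (Suc i))) *v (b (\<tau> (Suc i)) - b (\<tau> i))) - (b t + A *v conv b t)
      = A *v (LINT s:{0..t}|lborel. flow_kernel t s *v (\<beta> s - b s))"
proof -
  interpret mv: bounded_bilinear "(*v) :: real ^ 'n ^ 'n \<Rightarrow> real ^ 'n \<Rightarrow> real ^ 'n"
    by (rule bounded_bilinear_matrix_vector_mult)
  have b0: "b 0 = 0" and \<tau>0: "\<tau> 0 = 0" and \<tau>n: "\<tau> n = t"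
    using b \<tau> by (auto simp: admissible_def partition_of_def)
  define piece where "piece i s = indicator {\<tau> i<..\<tau> (Suc i)} s *\<^sub>R (flow_kernel t s *v b (\<tau> i))" for i s
  define F where "F i = E (ln (t / \<tau> i))" for i
  have piece: "integrable lborel (piece i) \<and>
      A *v (LINT s|lborel. piece i s) = F i *v b (\<tau> i) - F (Suc i) *v b (\<tau> i)" if "i < n" for i
  proof (cases "i = 0")
    case True
    then show ?thesis by (simp add: piece_def[abs_def] \<tau>0 b0 mv.zero_right)
  next
    case False
    then obtain j where "i = Suc j" by (cases i) auto
    then have "0 < \<tau> i"
      using \<tau> that partition_of_le[OF \<tau>, of 0 j] by (auto simp: partition_of_def intro: order.strict_trans1[of _ "\<tau> j"])
    moreover have "\<tau> i \<le> \<tau> (Suc i)" "\<tau> (Suc i) \<le> t"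
      using that partition_of_le[OF \<tau>] partition_of_bounds[OF \<tau>] by auto
    ultimately show ?thesis
      unfolding piece_def F_def using kernel_integral_Ioc by blast
  qed
  have \<beta>: "indicator {0..t} s *\<^sub>R (flow_kernel t s *v \<beta> s) = (\<Sum>i<n. piece i s)" for s
  proof -
    have "indicator {0..t} s *\<^sub>R piece i s = piece i s" if "i < n" for i
      using that partition_of_bounds[OF \<tau>, of i] partition_of_bounds[OF \<tau>, of "Suc i"]
      by (auto simp: piece_def split: split_indicator)
    moreover have "indicator {0..t} s *\<^sub>R (flow_kernel t s *v \<beta> s) = (\<Sum>i<n. indicator {0..t} s *\<^sub>R piece i s)"
      unfolding \<beta>_def piece_def mv.sum_right scaleR_sum_right mv.scaleR_right ..
    ultimately show ?thesis by simp
  qed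
  have int\<beta>: "set_integrable lborel {0..t} (\<lambda>s. flow_kernel t s *v \<beta> s)"
    unfolding set_integrable_def \<beta> using piece by (intro Bochner_Integration.integrable_sum) auto
  have intb: "set_integrable lborel {0..t} (\<lambda>s. flow_kernel t s *v b s)"
    using kernel_integrable[OF b] t by simp
  show "set_integrable lborel {0..t} (\<lambda>s. flow_kernel t s *v (\<beta> s - b s))"
    using set_integral_diff(1)[OF int\<beta> intb] by (simp add: mv.diff_right)
  have "(\<Sum>i<n. F (Suc i) *v (b (\<tau> (Suc i)) - b (\<tau> i)))
      = (\<Sum>i<n. F (Suc i) *v b (\<tau> (Suc i)) - F i *v b (\<tau> i)) + (\<Sum>i<n. F i *v b (\<tau> i) - F (Suc i) *v b (\<tau> i))"
    by (simp add: sum.distrib[symmetric] mv.diff_right)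
  also have "(\<Sum>i<n. F (Suc i) *v b (\<tau> (Suc i)) - F i *v b (\<tau> i)) = b t"
    using t by (subst sum_lessThan_telescope) (simp add: F_def \<tau>n \<tau>0 b0 E_0 mv.zero_right)
  also have "(\<Sum>i<n. F i *v b (\<tau> i) - F (Suc i) *v b (\<tau> i)) = A *v (LINT s:{0..t}|lborel. flow_kernel t s *v \<beta> s)"
    unfolding set_lebesgue_integral_def \<beta> using piece
    by (subst Bochner_Integration.integral_sum) (auto simp: mv.sum_right)
  finally show "(\<Sum>i<n. E (ln (t / \<tau> (Suc i))) *v (b (\<tau> (Suc i)) - b (\<tau> i))) - (b t + A *v conv b t)
      = A *v (LINT s:{0..t}|lborel. flow_kernel t s *v (\<beta> s - b s))"
    using set_integral_diff(2)[OF int\<beta> intb]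
    by (simp add: F_def conv_def mv.diff_right)
qed

lemma nn_integral_powr_finite:
  assumes "a > -1" "t \<ge> 0"
  shows "(\<integral>\<^sup>+s\<in>{0..t}. ennreal (s powr a) \<partial>lborel) < \<infinity>"
proof -
  have "(\<integral>\<^sup>+s. ennreal (norm (indicator {0..t} s *\<^sub>R s powr a)) \<partial>lborel) < \<infinity>"
    using set_integrable_powr[OF assms] unfolding set_integrable_def integrable_iff_bounded by blast
  moreover have "ennreal (norm (indicator {0..t} s *\<^sub>R s powr a)) = ennreal (s powr a) * indicator {0..t} s" for s
    by (auto split: split_indicator)
  ultimately show ?thesis by (simp only:)
qed

text \<open>The Cauchy-Schwarz inequality with \<open>s powr (- 1 - \<kappa>)\<close> split into the square roots of
\<open>s powr (- 1 / 2 - \<kappa>)\<close> and \<open>s powr (- 3 / 2 - \<kappa>)\<close>. The first is integrable as \<open>\<kappa> < 1 / 2\<close>; the second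
becomes comparable to it after taking expectations, since the expectation of \<open>(norm (\<beta> s - b s))\<^sup>2\<close> is of
order at most \<open>s\<close>.\<close>

lemma step_sum_error_le:
  assumes b: "admissible b" and t: "0 < t" and \<tau>: "partition_of n \<tau> t"
  defines "\<beta> \<equiv> \<lambda>s. \<Sum>i<n. indicator {\<tau> i<..\<tau> (Suc i)} s *\<^sub>R b (\<tau> i)"
  shows "ennreal ((norm ((\<Sum>i<n. E (ln (t / \<tau> (Suc i))) *v (b (\<tau> (Suc i)) - b (\<tau> i))) - (b t + A *v conv b t)))\<^sup>2)
    \<le> ennreal ((norm A * (K * t powr \<kappa>))\<^sup>2) * ((\<integral>\<^sup>+s\<in>{0..t}. ennreal (s powr (- 1 / 2 - \<kappa>)) \<partial>lborel) *
       (\<integral>\<^sup>+s\<in>{0..t}. ennreal (s powr (- 3 / 2 - \<kappa>) * (norm (\<beta> s - b s))\<^sup>2) \<partial>lborel))"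
proof -
  define e where "e = (\<Sum>i<n. E (ln (t / \<tau> (Suc i))) *v (b (\<tau> (Suc i)) - b (\<tau> i))) - (b t + A *v conv b t)"
  define I where "I = (LINT s:{0..t}|lborel. flow_kernel t s *v (\<beta> s - b s))"
  define g where "g s = s powr (- 1 - \<kappa>) * norm (\<beta> s - b s)" for s
  have int: "set_integrable lborel {0..t} (\<lambda>s. flow_kernel t s *v (\<beta> s - b s))" and e: "e = A *v I"
    using step_sum_by_parts[OF b t \<tau>] unfolding e_def I_def \<beta>_def by auto
  have \<beta>_meas: "(\<lambda>s. indicator {0..t} s *\<^sub>R (\<beta> s - b s)) \<in> borel_measurable lborel"
  proof -
    have "(\<lambda>s. indicator {0..t} s *\<^sub>R \<beta> s - indicator {0..t} s *\<^sub>R b s) \<in> borel_measurable lborel"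
      using admissible_measurable[OF b, of t] unfolding \<beta>_def by measurable
    then show ?thesis by (simp add: scaleR_diff_right)
  qed
  have "ennreal (norm I) \<le> (\<integral>\<^sup>+s. norm (indicator {0..t} s *\<^sub>R (flow_kernel t s *v (\<beta> s - b s))) \<partial>lborel)"
    unfolding I_def set_lebesgue_integral_def
    using int by (intro integral_norm_bound_ennreal) (simp add: set_integrable_def)
  also have "\<dots> \<le> (\<integral>\<^sup>+s. ennreal (K * t powr \<kappa>) * ennreal (indicator {0..t} s * g s) \<partial>lborel)"
    using norm_kernel_le K_nonneg
    by (intro nn_integral_mono) (auto simp: g_def ennreal_mult'[symmetric] split: split_indicator)
  also have "\<dots> = ennreal (K * t powr \<kappa>) * (\<integral>\<^sup>+s. ennreal (indicator {0..t} s * g s) \<partial>lborel)"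
  proof (rule nn_integral_cmult)
    have "(\<lambda>s. s powr (- 1 - \<kappa>) * norm (indicator {0..t} s *\<^sub>R (\<beta> s - b s))) \<in> borel_measurable lborel"
      using \<beta>_meas by measurable
    then show "(\<lambda>s. ennreal (indicator {0..t} s * g s)) \<in> borel_measurable lborel"
      by (simp add: g_def mult_ac)
  qed
  finally have I: "ennreal (norm I) \<le> ennreal (K * t powr \<kappa>) * (\<integral>\<^sup>+s. ennreal (indicator {0..t} s * g s) \<partial>lborel)" .
  define p where "p s = ennreal (indicator {0..t} s * s powr (- 1 / 4 - \<kappa> / 2))" for s
  define q where "q s = ennreal (s powr (- 3 / 4 - \<kappa> / 2) * norm (indicator {0..t} s *\<^sub>R (\<beta> s - b s)))" for s
  have [measurable]: "p \<in> borel_measurable lborel" unfolding p_def by measurable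
  have [measurable]: "q \<in> borel_measurable lborel" unfolding q_def using \<beta>_meas by measurable
  have "ennreal (indicator {0..t} s * g s) = p s * q s" for s
    by (auto simp: p_def q_def g_def ennreal_mult'[symmetric] mult.assoc[symmetric] simp flip: powr_add split: split_indicator)
  then have "(\<integral>\<^sup>+s. ennreal (indicator {0..t} s * g s) \<partial>lborel)\<^sup>2 \<le> (\<integral>\<^sup>+s. (p s)\<^sup>2 \<partial>lborel) * (\<integral>\<^sup>+s. (q s)\<^sup>2 \<partial>lborel)"
    using Cauchy_Schwarz_nn_integral[of p lborel q] by simp
  also have "(\<integral>\<^sup>+s. (p s)\<^sup>2 \<partial>lborel) = (\<integral>\<^sup>+s\<in>{0..t}. ennreal (s powr (- 1 / 2 - \<kappa>)) \<partial>lborel)"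
    by (intro nn_integral_cong)
      (auto simp: p_def power2_eq_square ennreal_mult'[symmetric] simp flip: powr_add split: split_indicator)
  also have "(\<integral>\<^sup>+s. (q s)\<^sup>2 \<partial>lborel) = (\<integral>\<^sup>+s\<in>{0..t}. ennreal (s powr (- 3 / 2 - \<kappa>) * (norm (\<beta> s - b s))\<^sup>2) \<partial>lborel)"
  proof (intro nn_integral_cong)
    fix s
    have "s powr (- 3 / 2 - \<kappa>) = (s powr (- 3 / 4 - \<kappa> / 2))\<^sup>2"
      by (simp add: power2_eq_square flip: powr_add)
    then show "(q s)\<^sup>2 = ennreal (s powr (- 3 / 2 - \<kappa>) * (norm (\<beta> s - b s))\<^sup>2) * indicator {0..t} s"
      by (auto simp: q_def ennreal_power power_mult_distrib split: split_indicator)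
  qed
  finally have CS: "(\<integral>\<^sup>+s. ennreal (indicator {0..t} s * g s) \<partial>lborel)\<^sup>2
      \<le> (\<integral>\<^sup>+s\<in>{0..t}. ennreal (s powr (- 1 / 2 - \<kappa>)) \<partial>lborel) *
        (\<integral>\<^sup>+s\<in>{0..t}. ennreal (s powr (- 3 / 2 - \<kappa>) * (norm (\<beta> s - b s))\<^sup>2) \<partial>lborel)" .
  have "ennreal ((norm e)\<^sup>2) \<le> ennreal ((norm A * norm I)\<^sup>2)"
    unfolding e by (intro ennreal_leI power_mono norm_matrix_vector_mult_le) auto
  also have "\<dots> = (ennreal (norm A))\<^sup>2 * (ennreal (norm I))\<^sup>2"
    by (simp add: ennreal_power[symmetric] ennreal_mult power_mult_distrib)
  also have "\<dots> \<le> (ennreal (norm A))\<^sup>2 * (ennreal (K * t powr \<kappa>) * (\<integral>\<^sup>+s. ennreal (indicator {0..t} s * g s) \<partial>lborel))\<^sup>2"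
    by (intro mult_left_mono power_mono I) auto
  also have "\<dots> = ennreal ((norm A * (K * t powr \<kappa>))\<^sup>2) * (\<integral>\<^sup>+s. ennreal (indicator {0..t} s * g s) \<partial>lborel)\<^sup>2"
    using K_nonneg by (simp add: power_mult_distrib ennreal_mult mult.assoc flip: ennreal_power)
  also have "\<dots> \<le> ennreal ((norm A * (K * t powr \<kappa>))\<^sup>2) * ((\<integral>\<^sup>+s\<in>{0..t}. ennreal (s powr (- 1 / 2 - \<kappa>)) \<partial>lborel) *
       (\<integral>\<^sup>+s\<in>{0..t}. ennreal (s powr (- 3 / 2 - \<kappa>) * (norm (\<beta> s - b s))\<^sup>2) \<partial>lborel))"
    by (intro mult_left_mono CS) auto
  finally show ?thesis unfolding e_def .
qed

end

lemma has_wiener_integral_cong_AE: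
  assumes X: "has_wiener_integral M B' t f X" and eq: "AE \<omega> in M. \<forall>t\<ge>0. B' t \<omega> = B t \<omega>"
  shows "has_wiener_integral M B t f X"
proof -
  obtain n \<tau> c where *: "\<And>k. partition_of (n k) (\<tau> k) t"
      "(\<lambda>k. \<integral>\<^sup>+s\<in>{0..t}. ennreal ((norm (step_fun (n k) (\<tau> k) (c k) s - f s))\<^sup>2) \<partial>lborel) \<longlonglongrightarrow> 0"
      "(\<lambda>k. \<integral>\<^sup>+\<omega>. ennreal ((norm (step_integral B' (n k) (\<tau> k) (c k) \<omega> - X \<omega>))\<^sup>2) \<partial>M) \<longlonglongrightarrow> 0"
    using X unfolding has_wiener_integral_def by blast
  have "(\<integral>\<^sup>+\<omega>. ennreal ((norm (step_integral B' (n k) (\<tau> k) (c k) \<omega> - X \<omega>))\<^sup>2) \<partial>M)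
      = (\<integral>\<^sup>+\<omega>. ennreal ((norm (step_integral B (n k) (\<tau> k) (c k) \<omega> - X \<omega>))\<^sup>2) \<partial>M)" for k
  proof (rule nn_integral_cong_AE)
    show "AE \<omega> in M. ennreal ((norm (step_integral B' (n k) (\<tau> k) (c k) \<omega> - X \<omega>))\<^sup>2)
        = ennreal ((norm (step_integral B (n k) (\<tau> k) (c k) \<omega> - X \<omega>))\<^sup>2)"
      using eq
    proof eventually_elim
      case (elim \<omega>)
      have "step_integral B' (n k) (\<tau> k) (c k) \<omega> = step_integral B (n k) (\<tau> k) (c k) \<omega>"
        unfolding step_integral_def using elim partition_of_bounds(1)[OF *(1)[of k]]
        by (intro sum.cong) auto
      then show ?case by simp
    qed
  qed
  then show ?thesis
    using X * unfolding has_wiener_integral_def by (intro conjI exI[of _ n] exI[of _ \<tau>] exI[of _ c]) auto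
qed

context subcritical_flow
begin

text \<open>On the cell of \<open>s\<close> the increment \<open>B (\<tau> j) - B s\<close> has second moment proportional to \<open>s - \<tau> j\<close>,
which is at most both \<open>s\<close> and \<open>h\<close>, hence at most \<open>s powr (1 - d) * h powr d\<close>. A small positive \<open>d\<close> gives a rate in
the mesh \<open>h\<close> while the remaining power of \<open>s\<close> stays integrable; \<open>d = 0\<close> gives a bound for a single cell.\<close>

lemma step_sum_error_expectation:
  fixes B :: "real \<Rightarrow> 'a \<Rightarrow> real ^ 'n"
  assumes M: "sigma_finite_measure M"
    and meas: "\<And>t. 0 \<le> t \<Longrightarrow> B t \<in> borel_measurable M"
    and cont: "\<And>\<omega>. \<omega> \<in> space M \<Longrightarrow> continuous_on {0..} (\<lambda>t. B t \<omega>)"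
    and moment: "\<And>s t. 0 \<le> s \<Longrightarrow> 0 \<le> t \<Longrightarrow>
      (\<integral>\<^sup>+\<omega>. ennreal ((norm (B t \<omega> - B s \<omega>))\<^sup>2) \<partial>M) = ennreal (C * \<bar>t - s\<bar>)"
    and C: "0 \<le> C" and \<tau>: "partition_of n \<tau> t"
    and mesh: "\<And>i. i < n \<Longrightarrow> \<tau> (Suc i) - \<tau> i \<le> h"
    and d: "0 \<le> d" "d \<le> 1"
  defines "Q \<equiv> \<lambda>\<omega>. \<integral>\<^sup>+s\<in>{0..t}. ennreal (s powr (- 3 / 2 - \<kappa>) *
        (norm ((\<Sum>i<n. indicator {\<tau> i<..\<tau> (Suc i)} s *\<^sub>R B (\<tau> i) \<omega>) - B s \<omega>))\<^sup>2) \<partial>lborel"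
  shows "Q \<in> borel_measurable M"
    and "(\<integral>\<^sup>+\<omega>. Q \<omega> \<partial>M) \<le> ennreal (C * h powr d) * (\<integral>\<^sup>+s\<in>{0..t}. ennreal (s powr (- 1 / 2 - \<kappa> - d)) \<partial>lborel)"
proof -
  interpret M: sigma_finite_measure M by (rule M)
  interpret pair_sigma_finite lborel M by unfold_locales
  define \<beta> where "\<beta> s \<omega> = (\<Sum>i<n. indicator {\<tau> i<..\<tau> (Suc i)} s *\<^sub>R B (\<tau> i) \<omega>)" for s \<omega>
  define f where "f s \<omega> = ennreal (s powr (- 3 / 2 - \<kappa>) * (norm (\<beta> s \<omega> - B s \<omega>))\<^sup>2) * indicator {0..t} s" for s \<omega>
  have [measurable]: "(\<lambda>p. B (\<tau> i) (snd p)) \<in> borel_measurable (lborel \<Otimes>\<^sub>M M)" if "i < n" for i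
    using meas[of "\<tau> i"] partition_of_bounds(1)[OF \<tau>, of i] that
    by (intro measurable_compose[OF measurable_snd]) simp
  have [measurable]: "(\<lambda>p. indicator {0..} (fst p) *\<^sub>R B (fst p) (snd p)) \<in> borel_measurable (lborel \<Otimes>\<^sub>M M)"
    using continuous_process_measurable_pair[of B M] meas cont by (simp add: case_prod_beta')
  have "(\<lambda>p. \<beta> (fst p) (snd p)) \<in> borel_measurable (lborel \<Otimes>\<^sub>M M)"
    unfolding \<beta>_def by measurable
  then have "(\<lambda>p. ennreal (fst p powr (- 3 / 2 - \<kappa>) * (norm (\<beta> (fst p) (snd p) - indicator {0..} (fst p) *\<^sub>R B (fst p) (snd p)))\<^sup>2) * indicator {0..t} (fst p))
      \<in> borel_measurable (lborel \<Otimes>\<^sub>M M)"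
    by measurable
  also have "(\<lambda>p. ennreal (fst p powr (- 3 / 2 - \<kappa>) * (norm (\<beta> (fst p) (snd p) - indicator {0..} (fst p) *\<^sub>R B (fst p) (snd p)))\<^sup>2) * indicator {0..t} (fst p))
      = case_prod f"
    by (auto simp: f_def fun_eq_iff split: split_indicator)
  finally have f: "case_prod f \<in> borel_measurable (lborel \<Otimes>\<^sub>M M)" .
  have Q: "Q = (\<lambda>\<omega>. \<integral>\<^sup>+s. f s \<omega> \<partial>lborel)"
    by (simp add: Q_def f_def \<beta>_def)
  show "Q \<in> borel_measurable M"
    unfolding Q using lborel.borel_measurable_nn_integral_fst[OF measurable_pair_swap[OF f]] by simp
  have le: "(\<integral>\<^sup>+\<omega>. f s \<omega> \<partial>M) \<le> ennreal (C * h powr d) * (ennreal (s powr (- 1 / 2 - \<kappa> - d)) * indicator {0..t} s)" for s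
  proof (cases "0 < s \<and> s \<le> t")
    case False
    then have "f s \<omega> = 0" for \<omega> by (auto simp: f_def split: split_indicator)
    then show ?thesis by simp
  next
    case True
    then obtain j where j: "j < n" "\<tau> j < s" "s \<le> \<tau> (Suc j)"
      using partition_of_cell[OF \<tau>] by blast
    have \<tau>j: "0 \<le> \<tau> j" using partition_of_bounds(1)[OF \<tau>, of j] j by simp
    have [measurable]: "B (\<tau> j) \<in> borel_measurable M" "B s \<in> borel_measurable M"
      using meas \<tau>j True by auto
    have "\<beta> s \<omega> = B (\<tau> j) \<omega>" for \<omega>
      unfolding \<beta>_def by (rule partition_sum_eq[OF \<tau> j])
    then have "(\<integral>\<^sup>+\<omega>. f s \<omega> \<partial>M) = (\<integral>\<^sup>+\<omega>. ennreal (s powr (- 3 / 2 - \<kappa>)) * ennreal ((norm (B (\<tau> j) \<omega> - B s \<omega>))\<^sup>2) \<partial>M)"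
      using True by (simp add: f_def ennreal_mult)
    also have "\<dots> = ennreal (s powr (- 3 / 2 - \<kappa>)) * ennreal (C * \<bar>\<tau> j - s\<bar>)"
    proof (subst nn_integral_cmult)
      show "(\<lambda>\<omega>. ennreal ((norm (B (\<tau> j) \<omega> - B s \<omega>))\<^sup>2)) \<in> borel_measurable M"
        by measurable
    qed (use moment[of s "\<tau> j"] \<tau>j True in simp)
    also have "\<dots> = ennreal (s powr (- 3 / 2 - \<kappa>) * (C * (s - \<tau> j)))"
      using j C by (simp add: ennreal_mult')
    also have "\<dots> \<le> ennreal (C * h powr d * s powr (- 1 / 2 - \<kappa> - d))"
    proof (rule ennreal_leI)
      have "s - \<tau> j = (s - \<tau> j) powr (1 - d) * (s - \<tau> j) powr d"
        using j by (simp flip: powr_add)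
      also have "\<dots> \<le> s powr (1 - d) * h powr d"
        using j \<tau>j d True mesh[OF j(1)] by (intro mult_mono powr_mono2) auto
      finally have "s powr (- 3 / 2 - \<kappa>) * (C * (s - \<tau> j)) \<le> s powr (- 3 / 2 - \<kappa>) * (C * (s powr (1 - d) * h powr d))"
        using C by (intro mult_left_mono) auto
      also have "\<dots> = C * h powr d * (s powr (- 3 / 2 - \<kappa>) * s powr (1 - d))"
        by (simp add: mult_ac)
      also have "s powr (- 3 / 2 - \<kappa>) * s powr (1 - d) = s powr (- 1 / 2 - \<kappa> - d)"
      proof -
        have "- 3 / 2 - \<kappa> + (1 - d) = - 1 / 2 - \<kappa> - d" by simp
        then show ?thesis by (simp only: powr_add[symmetric])
      qed
      finally show "s powr (- 3 / 2 - \<kappa>) * (C * (s - \<tau> j)) \<le> C * h powr d * s powr (- 1 / 2 - \<kappa> - d)" .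
    qed
    also have "\<dots> = ennreal (C * h powr d) * (ennreal (s powr (- 1 / 2 - \<kappa> - d)) * indicator {0..t} s)"
      using True C by (simp add: ennreal_mult')
    finally show ?thesis .
  qed
  have "(\<integral>\<^sup>+\<omega>. (\<integral>\<^sup>+s. f s \<omega> \<partial>lborel) \<partial>M) = (\<integral>\<^sup>+s. (\<integral>\<^sup>+\<omega>. f s \<omega> \<partial>M) \<partial>lborel)"
    by (rule Fubini'[OF f])
  also have "\<dots> \<le> (\<integral>\<^sup>+s. ennreal (C * h powr d) * (ennreal (s powr (- 1 / 2 - \<kappa> - d)) * indicator {0..t} s) \<partial>lborel)"
    by (intro nn_integral_mono le)
  also have "\<dots> = ennreal (C * h powr d) * (\<integral>\<^sup>+s\<in>{0..t}. ennreal (s powr (- 1 / 2 - \<kappa> - d)) \<partial>lborel)"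
    by (rule nn_integral_cmult) measurable
  finally show "(\<integral>\<^sup>+\<omega>. Q \<omega> \<partial>M) \<le> ennreal (C * h powr d) * (\<integral>\<^sup>+s\<in>{0..t}. ennreal (s powr (- 1 / 2 - \<kappa> - d)) \<partial>lborel)"
    by (simp only: Q)
qed

text \<open>Dominated convergence: the step function takes the value \<open>E (ln (t / r))\<close> at a point \<open>r \<ge> s\<close> close to \<open>s\<close>,
and to the right of \<open>s\<close> the bound \<open>K * t powr \<kappa> * r powr (- \<kappa>)\<close> only decreases. This is why right endpoints are
used.\<close>

lemma flow_step_fun_tendsto:
  assumes t: "0 < t"
  defines "\<tau> \<equiv> \<lambda>k i. real i * t / real (Suc k)"
  shows "(\<lambda>k. \<integral>\<^sup>+s\<in>{0..t}. ennreal ((norm (step_fun (Suc k) (\<tau> k) (\<lambda>i. E (ln (t / \<tau> k (Suc i)))) s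
    - E (ln (t / s))))\<^sup>2) \<partial>lborel) \<longlonglongrightarrow> 0"
proof -
  define S where "S k = step_fun (Suc k) (\<tau> k) (\<lambda>i. E (ln (t / \<tau> k (Suc i))))" for k
  have \<tau>: "partition_of (Suc k) (\<tau> k) t" for k
    unfolding \<tau>_def by (rule uniform_partition[OF t])
  have cell: "\<exists>r. s \<le> r \<and> r \<le> s + t / real (Suc k) \<and> r \<le> t \<and> S k s = E (ln (t / r))" if s: "0 < s" "s \<le> t" for s k
  proof -
    obtain j where j: "j < Suc k" "\<tau> k j < s" "s \<le> \<tau> k (Suc j)"
      using partition_of_cell[OF \<tau> s] by blast
    have "S k s = E (ln (t / \<tau> k (Suc j)))"
      unfolding S_def step_fun_def by (rule partition_sum_eq[OF \<tau> j])
    moreover have "\<tau> k (Suc j) = \<tau> k j + t / real (Suc k)"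
      using uniform_partition_step[of j t "real (Suc k)"] by (simp add: \<tau>_def)
    ultimately show ?thesis
      using j partition_of_bounds(2)[OF \<tau>, of "Suc j" k] by (intro exI[of _ "\<tau> k (Suc j)"]) auto
  qed
  have "(\<lambda>k. \<integral>\<^sup>+s. ennreal ((norm (S k s - E (ln (t / s))))\<^sup>2) * indicator {0..t} s \<partial>lborel)
      \<longlonglongrightarrow> (\<integral>\<^sup>+s. 0 \<partial>(lborel :: real measure))"
  proof (rule nn_integral_dominated_convergence)
    have [measurable]: "S k \<in> borel_measurable lborel" for k
      using step_fun_measurable[of "Suc k" "\<tau> k"] by (simp add: S_def)
    show "(\<lambda>s. ennreal ((norm (S k s - E (ln (t / s))))\<^sup>2) * indicator {0..t} s) \<in> borel_measurable lborel" for k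
      by measurable
    define w where "w s = ennreal ((2 * K * t powr \<kappa>)\<^sup>2) * (ennreal (s powr (- 2 * \<kappa>)) * indicator {0..t} s)" for s
    show "w \<in> borel_measurable lborel" unfolding w_def by measurable
    show "(\<integral>\<^sup>+s. w s \<partial>lborel) < \<infinity>"
      using nn_integral_powr_finite[of "- 2 * \<kappa>" t] t lambda_less unfolding w_def
      by (subst nn_integral_cmult) (auto simp: ennreal_mult_less_top)
    have nz: "AE s in lborel. s \<noteq> (0 :: real)" by (rule AE_lborel_singleton)
    have bound: "(norm (S k s - E (ln (t / s))))\<^sup>2 \<le> (2 * K * t powr \<kappa>)\<^sup>2 * s powr (- 2 * \<kappa>)" if s: "0 < s" "s \<le> t" for s k
    proof -
      obtain r where r: "s \<le> r" "r \<le> t" "S k s = E (ln (t / r))" using cell[OF s] by blast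
      have "norm (S k s) \<le> K * (t powr \<kappa> * r powr (- \<kappa>))"
        using norm_E_ln_le[of r t] r s by simp
      also have "\<dots> \<le> K * (t powr \<kappa> * s powr (- \<kappa>))"
        using r s lambda_pos K_nonneg by (intro mult_left_mono powr_mono2') auto
      finally have "norm (S k s - E (ln (t / s))) \<le> 2 * K * t powr \<kappa> * s powr (- \<kappa>)"
        using norm_E_ln_le[OF s] norm_triangle_ineq4[of "S k s" "E (ln (t / s))"] by simp
      then have "(norm (S k s - E (ln (t / s))))\<^sup>2 \<le> (2 * K * t powr \<kappa> * s powr (- \<kappa>))\<^sup>2"
        by (intro power_mono) auto
      also have "(s powr (- \<kappa>))\<^sup>2 = s powr (- 2 * \<kappa>)"
        by (simp add: power2_eq_square flip: powr_add)
      then have "(2 * K * t powr \<kappa> * s powr (- \<kappa>))\<^sup>2 = (2 * K * t powr \<kappa>)\<^sup>2 * s powr (- 2 * \<kappa>)"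
        by (simp only: power_mult_distrib)
      finally show ?thesis .
    qed
    show "AE s in lborel. ennreal ((norm (S k s - E (ln (t / s))))\<^sup>2) * indicator {0..t} s \<le> w s" for k
      using nz
    proof eventually_elim
      case (elim s)
      show ?case
        using bound[of s k] elim
        by (auto simp: w_def ennreal_mult'[symmetric] intro!: ennreal_leI split: split_indicator)
    qed
    show "AE s in lborel. (\<lambda>k. ennreal ((norm (S k s - E (ln (t / s))))\<^sup>2) * indicator {0..t} s) \<longlonglongrightarrow> 0"
      using nz
    proof eventually_elim
      case (elim s)
      show ?case
      proof (cases "0 < s \<and> s \<le> t")
        case True
        then obtain r where r: "\<And>k. s \<le> r k" "\<And>k. r k \<le> s + t / real (Suc k)" "\<And>k. S k s = E (ln (t / r k))"
          using cell[of s] by metis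
        have "r \<longlonglongrightarrow> s"
        proof (rule tendsto_sandwich[OF _ _ tendsto_const])
          show "(\<lambda>k. s + t / real (Suc k)) \<longlonglongrightarrow> s"
            using tendsto_add[OF tendsto_const lim_const_over_n[THEN LIMSEQ_Suc], of s t] by simp
        qed (use r in auto)
        moreover have "continuous_on {0<..} (\<lambda>r. E (ln (t / r)))"
          using t by (intro continuous_intros) auto
        ultimately have "(\<lambda>k. E (ln (t / r k))) \<longlonglongrightarrow> E (ln (t / s))"
          using True r(1) by (intro continuous_on_tendsto_compose[where f = "\<lambda>r. E (ln (t / r))"])
            (auto intro!: always_eventually intro: order.strict_trans2)
        then have "(\<lambda>k. (norm (S k s - E (ln (t / s))))\<^sup>2) \<longlonglongrightarrow> (norm (E (ln (t / s)) - E (ln (t / s))))\<^sup>2"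
          unfolding r(3) by (intro tendsto_intros)
        then have "(\<lambda>k. ennreal ((norm (S k s - E (ln (t / s))))\<^sup>2)) \<longlonglongrightarrow> ennreal 0"
          by (intro tendsto_ennrealI) simp
        then show ?thesis using True by simp
      qed (use elim in auto)
    qed
  qed auto
  then show ?thesis by (simp add: S_def)
qed

lemma conv_measurable:
  fixes B :: "real \<Rightarrow> 'a \<Rightarrow> real ^ 'n"
  assumes meas: "\<And>t. 0 \<le> t \<Longrightarrow> B t \<in> borel_measurable M"
    and cont: "\<And>\<omega>. \<omega> \<in> space M \<Longrightarrow> continuous_on {0..} (\<lambda>t. B t \<omega>)"
  shows "(\<lambda>\<omega>. conv (\<lambda>s. B s \<omega>) t) \<in> borel_measurable M"
proof -
  have [measurable]: "(\<lambda>p. indicator {0..} (fst p) *\<^sub>R B (fst p) (snd p)) \<in> borel_measurable (lborel \<Otimes>\<^sub>M M)"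
    using continuous_process_measurable_pair[of B M] meas cont by (simp add: case_prod_beta')
  have "(\<lambda>p. indicator {0..} (snd p) *\<^sub>R B (snd p) (fst p)) \<in> borel_measurable (M \<Otimes>\<^sub>M lborel)"
    using measurable_compose[OF measurable_Pair[OF measurable_snd measurable_fst]
      \<open>(\<lambda>p. indicator {0..} (fst p) *\<^sub>R B (fst p) (snd p)) \<in> borel_measurable (lborel \<Otimes>\<^sub>M M)\<close>] by simp
  then have [measurable]: "(\<lambda>(\<omega>, s). indicator {0..} s *\<^sub>R B s \<omega>) \<in> borel_measurable (M \<Otimes>\<^sub>M lborel)"
    by (simp add: case_prod_beta')
  have "(\<lambda>\<omega>. LINT s|lborel. indicator {0..t} s *\<^sub>R (flow_kernel t s *v (indicator {0..} s *\<^sub>R B s \<omega>))) \<in> borel_measurable M"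
    by (rule lborel.borel_measurable_lebesgue_integral) measurable
  moreover have "indicator {0..t} s *\<^sub>R (flow_kernel t s *v (indicator {0..} s *\<^sub>R B s \<omega>))
      = indicator {0..t} s *\<^sub>R (flow_kernel t s *v B s \<omega>)" for s \<omega>
    by (auto split: split_indicator)
  ultimately show ?thesis by (simp add: conv_def set_lebesgue_integral_def)
qed

text \<open>The integrals of the step functions on uniform partitions converge in \<open>L\<^sup>2(M)\<close> to the path formula
that integration by parts suggests.\<close>

theorem has_wiener_integral_flow:
  fixes B :: "real \<Rightarrow> 'a \<Rightarrow> real ^ 'n"
  assumes M: "sigma_finite_measure M"
    and meas: "\<And>t. 0 \<le> t \<Longrightarrow> B t \<in> borel_measurable M"
    and adm: "\<And>\<omega>. \<omega> \<in> space M \<Longrightarrow> admissible (\<lambda>t. B t \<omega>)"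
    and moment: "\<And>s t. 0 \<le> s \<Longrightarrow> 0 \<le> t \<Longrightarrow>
      (\<integral>\<^sup>+\<omega>. ennreal ((norm (B t \<omega> - B s \<omega>))\<^sup>2) \<partial>M) = ennreal (C * \<bar>t - s\<bar>)"
    and C: "0 \<le> C" and t: "0 < t"
  shows "has_wiener_integral M B t (\<lambda>s. E (ln (t / s))) (\<lambda>\<omega>. B t \<omega> + A *v conv (\<lambda>s. B s \<omega>) t)"
proof -
  have cont: "continuous_on {0..} (\<lambda>t. B t \<omega>)" if "\<omega> \<in> space M" for \<omega>
    using adm[OF that] by (simp add: admissible_def)
  define \<tau> where "\<tau> k i = real i * t / real (Suc k)" for k i
  define c where "c k i = E (ln (t / \<tau> k (Suc i)))" for k i
  (* Half of the gap 1 / 2 - \<kappa>, so that s powr (- 1 / 2 - \<kappa> - d) is still integrable at 0. *)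
  define d where "d = (1 / 2 - \<kappa>) / 2"
  have d: "0 < d" "d \<le> 1" "- 1 / 2 - \<kappa> - d > - 1"
    using lambda_pos lambda_less by (auto simp: d_def field_simps)
  define X where "X \<omega> = B t \<omega> + A *v conv (\<lambda>s. B s \<omega>) t" for \<omega>
  define Q where "Q k \<omega> = (\<integral>\<^sup>+s\<in>{0..t}. ennreal (s powr (- 3 / 2 - \<kappa>) *
      (norm ((\<Sum>i<Suc k. indicator {\<tau> k i<..\<tau> k (Suc i)} s *\<^sub>R B (\<tau> k i) \<omega>) - B s \<omega>))\<^sup>2) \<partial>lborel)" for k \<omega>
  define c0 where "c0 = ennreal ((norm A * (K * t powr \<kappa>))\<^sup>2)"
  define c1 where "c1 = (\<integral>\<^sup>+s\<in>{0..t}. ennreal (s powr (- 1 / 2 - \<kappa>)) \<partial>lborel)"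
  define c2 where "c2 = (\<integral>\<^sup>+s\<in>{0..t}. ennreal (s powr (- 1 / 2 - \<kappa> - d)) \<partial>lborel)"
  have fin: "c1 < \<top>" "c2 < \<top>"
    unfolding c1_def c2_def using nn_integral_powr_finite[of _ t] d lambda_less t by (auto simp: top_ennreal_def)
  have part: "partition_of (Suc k) (\<tau> k) t" for k
    unfolding \<tau>_def by (rule uniform_partition[OF t])
  have mesh: "\<tau> k (Suc i) - \<tau> k i \<le> t / real (Suc k)" for k i
    using uniform_partition_step[of i t "real (Suc k)"] by (simp add: \<tau>_def)
  have Q: "Q k \<in> borel_measurable M" "(\<integral>\<^sup>+\<omega>. Q k \<omega> \<partial>M) \<le> ennreal (C * (t / real (Suc k)) powr d) * c2" for k
    unfolding Q_def c2_def
    by (rule step_sum_error_expectation[where B = B and M = M and C = C and n = "Suc k" and \<tau> = "\<tau> k" and t = t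
      and h = "t / real (Suc k)" and d = d, OF M meas cont moment C part mesh less_imp_le[OF d(1)] d(2)]; assumption)+
  have le: "(\<integral>\<^sup>+\<omega>. ennreal ((norm (step_integral B (Suc k) (\<tau> k) (c k) \<omega> - X \<omega>))\<^sup>2) \<partial>M)
      \<le> c0 * (c1 * (c2 * ennreal (C * (t / real (Suc k)) powr d)))" for k
  proof -
    have "(\<integral>\<^sup>+\<omega>. ennreal ((norm (step_integral B (Suc k) (\<tau> k) (c k) \<omega> - X \<omega>))\<^sup>2) \<partial>M) \<le> (\<integral>\<^sup>+\<omega>. (c0 * c1) * Q k \<omega> \<partial>M)"
      using step_sum_error_le[OF adm t part]
      by (intro nn_integral_mono) (simp add: step_integral_def c_def X_def c0_def c1_def Q_def mult.assoc)
    also have "\<dots> = (c0 * c1) * (\<integral>\<^sup>+\<omega>. Q k \<omega> \<partial>M)"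
      by (rule nn_integral_cmult[OF Q(1)])
    also have "\<dots> \<le> (c0 * c1) * (ennreal (C * (t / real (Suc k)) powr d) * c2)"
      by (intro mult_left_mono Q(2)) simp
    finally show ?thesis by (simp only: mult_ac)
  qed
  have "(\<lambda>k. (t / real (Suc k)) powr d) \<longlonglongrightarrow> 0 powr d"
    using d t lim_const_over_n[THEN LIMSEQ_Suc, of t] by (intro tendsto_powr2) auto
  then have "(\<lambda>k. c0 * (c1 * (c2 * ennreal (C * (t / real (Suc k)) powr d))))
      \<longlonglongrightarrow> c0 * (c1 * (c2 * ennreal (C * 0 powr d)))"
    using fin by (intro ennreal_tendsto_cmult tendsto_ennrealI tendsto_mult tendsto_const) (simp_all add: c0_def)
  then have upper: "(\<lambda>k. c0 * (c1 * (c2 * ennreal (C * (t / real (Suc k)) powr d)))) \<longlonglongrightarrow> 0"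
    using d(1) by simp
  have lim: "(\<lambda>k. \<integral>\<^sup>+\<omega>. ennreal ((norm (step_integral B (Suc k) (\<tau> k) (c k) \<omega> - X \<omega>))\<^sup>2) \<partial>M) \<longlonglongrightarrow> 0"
    by (rule tendsto_sandwich[OF _ _ tendsto_const upper]) (use le in \<open>simp_all add: always_eventually del: of_nat_Suc\<close>)
  have step: "(\<lambda>k. \<integral>\<^sup>+s\<in>{0..t}. ennreal ((norm (step_fun (Suc k) (\<tau> k) (c k) s - E (ln (t / s))))\<^sup>2) \<partial>lborel) \<longlonglongrightarrow> 0"
    using flow_step_fun_tendsto[OF t] unfolding \<tau>_def c_def by simp
  have Em: "set_borel_measurable lborel {0..t} (\<lambda>s. E (ln (t / s)))"
    unfolding set_borel_measurable_def by measurable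
  have Xm: "X \<in> borel_measurable M"
    unfolding X_def using t
    by (intro borel_measurable_add borel_measurable_matrix_vector_mult borel_measurable_const
      conv_measurable meas cont) auto
  show ?thesis
    unfolding X_def[symmetric] has_wiener_integral_def
    by (intro conjI exI[of _ Suc] exI[of _ \<tau>] exI[of _ c] allI Em Xm part step lim)
qed

end

section \<open>An admissible version of Brownian motion and the integral equation\<close>

lemma brownian_vec_paths:
  fixes B :: "real \<Rightarrow> 'a \<Rightarrow> real ^ 'n"
  assumes "standard_brownian_motion_vec M B"
  shows "AE \<omega> in M. continuous_on {0..} (\<lambda>t. B t \<omega>) \<and> B 0 \<omega> = 0"
proof -
  have "AE \<omega> in M. \<forall>j. continuous_on {0..} (\<lambda>t. B t \<omega> $ j) \<and> B 0 \<omega> $ j = 0"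
    using assms by (auto simp: AE_all_countable standard_brownian_motion_vec_def standard_brownian_motion_def)
  then show ?thesis
  proof eventually_elim
    case (elim \<omega>)
    then have "continuous_on {0..} (\<lambda>t. \<chi> j. B t \<omega> $ j)"
      by (intro continuous_on_vec_lambda) auto
    then show ?case using elim by (simp add: vec_eq_iff)
  qed
qed

context subcritical_flow
begin

text \<open>Pointwise \<open>s powr (- 1 - \<kappa>) * norm (b s)\<close> is a product \<open>x * y\<close> with \<open>x\<^sup>2 = s powr (- 1 / 2 - \<kappa>)\<close> and
\<open>y\<^sup>2 = s powr (- 3 / 2 - \<kappa>) * (norm (b s))\<^sup>2\<close>, and \<open>x * y \<le> x\<^sup>2 + y\<^sup>2\<close>. The integral of \<open>y\<^sup>2\<close> has finite expectation,
being the quantity of \<open>step_sum_error_expectation\<close> for the partition with one cell, on which the path is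
frozen at its starting value \<open>0\<close>.\<close>

lemma AE_admissible:
  fixes B :: "real \<Rightarrow> 'a \<Rightarrow> real ^ 'n"
  assumes M: "sigma_finite_measure M"
    and meas: "\<And>t. 0 \<le> t \<Longrightarrow> B t \<in> borel_measurable M"
    and path: "\<And>\<omega>. \<omega> \<in> space M \<Longrightarrow> continuous_on {0..} (\<lambda>t. B t \<omega>) \<and> B 0 \<omega> = 0"
    and moment: "\<And>s t. 0 \<le> s \<Longrightarrow> 0 \<le> t \<Longrightarrow>
      (\<integral>\<^sup>+\<omega>. ennreal ((norm (B t \<omega> - B s \<omega>))\<^sup>2) \<partial>M) = ennreal (C * \<bar>t - s\<bar>)"
    and C: "0 \<le> C"
  shows "AE \<omega> in M. admissible (\<lambda>t. B t \<omega>)"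
proof -
  interpret M: sigma_finite_measure M by (rule M)
  have cont: "continuous_on {0..} (\<lambda>t. B t \<omega>)" if "\<omega> \<in> space M" for \<omega>
    using path[OF that] by simp
  have fin: "AE \<omega> in M. (\<integral>\<^sup>+s\<in>{0..real m}. ennreal (s powr (- 3 / 2 - \<kappa>) * (norm (B s \<omega>))\<^sup>2) \<partial>lborel) < \<infinity>" for m
  proof (cases "m = 0")
    case False
    define \<tau> where "\<tau> i = real i * real m" for i
    have part: "partition_of 1 \<tau> (real m)"
      using uniform_partition[of "real m" 0] False by (simp add: \<tau>_def[abs_def])
    define Q where "Q \<omega> = (\<integral>\<^sup>+s\<in>{0..real m}. ennreal (s powr (- 3 / 2 - \<kappa>) *
        (norm ((\<Sum>i<1. indicator {\<tau> i<..\<tau> (Suc i)} s *\<^sub>R B (\<tau> i) \<omega>) - B s \<omega>))\<^sup>2) \<partial>lborel)" for \<omega>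
    have mesh: "\<tau> (Suc i) - \<tau> i \<le> real m" for i by (simp add: \<tau>_def distrib_right)
    note * = step_sum_error_expectation[where B = B and M = M and C = C and n = 1 and \<tau> = \<tau> and t = "real m"
      and h = "real m" and d = 0, OF M meas cont moment C part mesh order.refl zero_le_one]
    have "Q \<in> borel_measurable M"
      unfolding Q_def by (rule *(1); assumption)
    moreover have "(\<integral>\<^sup>+\<omega>. Q \<omega> \<partial>M) \<le> ennreal (C * real m powr 0) * (\<integral>\<^sup>+s\<in>{0..real m}. ennreal (s powr (- 1 / 2 - \<kappa> - 0)) \<partial>lborel)"
      unfolding Q_def by (rule *(2); assumption)
    then have "(\<integral>\<^sup>+\<omega>. Q \<omega> \<partial>M) < \<infinity>"
      using nn_integral_powr_finite[of "- 1 / 2 - \<kappa>" "real m"] lambda_less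
      by (auto simp: ennreal_mult_less_top elim!: order.strict_trans1)
    ultimately have "AE \<omega> in M. Q \<omega> \<noteq> \<infinity>"
      by (intro nn_integral_PInf_AE) auto
    then show ?thesis
      using AE_space
    proof eventually_elim
      case (elim \<omega>)
      have "\<tau> 0 = 0" by (simp add: \<tau>_def)
      then have "Q \<omega> = (\<integral>\<^sup>+s\<in>{0..real m}. ennreal (s powr (- 3 / 2 - \<kappa>) * (norm (B s \<omega>))\<^sup>2) \<partial>lborel)"
        using path[OF elim(2)] by (simp add: Q_def)
      then show ?case using elim(1) by (simp add: less_top)
    qed
  next
    case True
    have "(\<integral>\<^sup>+s\<in>{0..real m}. ennreal (s powr (- 3 / 2 - \<kappa>) * (norm (B s \<omega>))\<^sup>2) \<partial>lborel) = (\<integral>\<^sup>+s. 0 \<partial>(lborel :: real measure))" for \<omega>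
      using True by (intro nn_integral_cong) (auto split: split_indicator)
    then show ?thesis by simp
  qed
  have "AE \<omega> in M. \<forall>m. (\<integral>\<^sup>+s\<in>{0..real m}. ennreal (s powr (- 3 / 2 - \<kappa>) * (norm (B s \<omega>))\<^sup>2) \<partial>lborel) < \<infinity>"
    unfolding AE_all_countable using fin by blast
  then show ?thesis
    using AE_space
  proof eventually_elim
    case (elim \<omega>)
    define b where "b s = B s \<omega>" for s
    have b: "continuous_on {0..} b" "b 0 = 0"
      using path[OF elim(2)] by (auto simp: b_def[abs_def])
    have "set_integrable lborel {0..t} (\<lambda>s. s powr (- 1 - \<kappa>) * norm (b s))" if t: "0 \<le> t" for t
    proof -
      obtain m where m: "t \<le> real m" using real_arch_simple by blast
      have "continuous_on {0..t} b" using b(1) by (rule continuous_on_subset) auto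
      then have [measurable]: "(\<lambda>s. indicator {0..t} s *\<^sub>R b s) \<in> borel_measurable borel"
        by (rule borel_measurable_continuous_on_indicator[rotated]) simp
      have "set_integrable lborel {0..t} (\<lambda>s. s powr (- 3 / 2 - \<kappa>) * (norm (b s))\<^sup>2)"
        unfolding set_integrable_def
      proof (rule integrableI_bounded)
        have "(\<lambda>s. s powr (- 3 / 2 - \<kappa>) * (norm (indicator {0..t} s *\<^sub>R b s))\<^sup>2) \<in> borel_measurable lborel"
          by measurable
        also have "(\<lambda>s. s powr (- 3 / 2 - \<kappa>) * (norm (indicator {0..t} s *\<^sub>R b s))\<^sup>2)
            = (\<lambda>s. indicator {0..t} s *\<^sub>R (s powr (- 3 / 2 - \<kappa>) * (norm (b s))\<^sup>2))"
          by (auto simp: fun_eq_iff split: split_indicator)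
        finally show "(\<lambda>s. indicator {0..t} s *\<^sub>R (s powr (- 3 / 2 - \<kappa>) * (norm (b s))\<^sup>2)) \<in> borel_measurable lborel" .
        have "(\<integral>\<^sup>+s. ennreal (norm (indicator {0..t} s *\<^sub>R (s powr (- 3 / 2 - \<kappa>) * (norm (b s))\<^sup>2))) \<partial>lborel)
            \<le> (\<integral>\<^sup>+s\<in>{0..real m}. ennreal (s powr (- 3 / 2 - \<kappa>) * (norm (b s))\<^sup>2) \<partial>lborel)"
          using m by (intro nn_integral_mono) (auto split: split_indicator)
        also have "\<dots> < \<infinity>" using elim(1) by (simp add: b_def)
        finally show "(\<integral>\<^sup>+s. ennreal (norm (indicator {0..t} s *\<^sub>R (s powr (- 3 / 2 - \<kappa>) * (norm (b s))\<^sup>2))) \<partial>lborel) < \<infinity>" .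
      qed
      then have int: "set_integrable lborel {0..t} (\<lambda>s. s powr (- 1 / 2 - \<kappa>) + s powr (- 3 / 2 - \<kappa>) * (norm (b s))\<^sup>2)"
        using t lambda_less by (intro set_integral_add set_integrable_powr) auto
      show ?thesis
        unfolding set_integrable_def
      proof (rule Bochner_Integration.integrable_bound[OF int[unfolded set_integrable_def]])
        have "(\<lambda>s. s powr (- 1 - \<kappa>) * norm (indicator {0..t} s *\<^sub>R b s)) \<in> borel_measurable lborel"
          by measurable
        also have "(\<lambda>s. s powr (- 1 - \<kappa>) * norm (indicator {0..t} s *\<^sub>R b s))
            = (\<lambda>s. indicator {0..t} s *\<^sub>R (s powr (- 1 - \<kappa>) * norm (b s)))"
          by (auto simp: fun_eq_iff)
        finally show "(\<lambda>s. indicator {0..t} s *\<^sub>R (s powr (- 1 - \<kappa>) * norm (b s))) \<in> borel_measurable lborel" .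
        have "s powr (- 1 - \<kappa>) * norm (b s) \<le> s powr (- 1 / 2 - \<kappa>) + s powr (- 3 / 2 - \<kappa>) * (norm (b s))\<^sup>2" for s
        proof -
          define x where "x = s powr (- 1 / 4 - \<kappa> / 2)"
          define y where "y = s powr (- 3 / 4 - \<kappa> / 2) * norm (b s)"
          have "x * y = s powr (- 1 - \<kappa>) * norm (b s)"
            by (simp add: x_def y_def mult.assoc[symmetric] flip: powr_add)
          moreover have "x\<^sup>2 = s powr (- 1 / 2 - \<kappa>)"
            by (simp add: x_def power2_eq_square flip: powr_add)
          moreover have "(s powr (- 3 / 4 - \<kappa> / 2))\<^sup>2 = s powr (- 3 / 2 - \<kappa>)"
            by (simp add: power2_eq_square flip: powr_add)
          then have "y\<^sup>2 = s powr (- 3 / 2 - \<kappa>) * (norm (b s))\<^sup>2"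
            by (simp add: y_def power_mult_distrib)
          moreover have "x * y \<le> x\<^sup>2 + y\<^sup>2"
          proof -
            have "0 \<le> x * y" by (simp add: x_def y_def)
            then show ?thesis using sum_squares_bound[of x y] by linarith
          qed
          ultimately show ?thesis by simp
        qed
        then show "AE s in lborel. norm (indicator {0..t} s *\<^sub>R (s powr (- 1 - \<kappa>) * norm (b s)))
            \<le> norm (indicator {0..t} s *\<^sub>R (s powr (- 1 / 2 - \<kappa>) + s powr (- 3 / 2 - \<kappa>) * (norm (b s))\<^sup>2))"
          by (intro AE_I2) (auto split: split_indicator)
      qed
    qed
    then show ?case using b by (simp add: admissible_def b_def[abs_def])
  qed
qed

text \<open>Two modifications on null sets: the first makes all paths continuous, hence the process jointly
measurable, which the proof of almost sure admissibility requires; the second makes all paths admissible.\<close>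

lemma brownian_admissible_version:
  fixes B :: "real \<Rightarrow> 'a \<Rightarrow> real ^ 'n"
  assumes B: "standard_brownian_motion_vec M B"
  obtains B' where "\<And>t. 0 \<le> t \<Longrightarrow> B' t \<in> borel_measurable M"
    and "\<And>\<omega>. \<omega> \<in> space M \<Longrightarrow> admissible (\<lambda>t. B' t \<omega>)"
    and "AE \<omega> in M. \<forall>t. B' t \<omega> = B t \<omega>"
proof -
  have "prob_space M" using B by (simp add: standard_brownian_motion_vec_def standard_brownian_motion_def)
  then interpret prob_space M .
  obtain B1 where B1: "\<And>t. 0 \<le> t \<Longrightarrow> B1 t \<in> borel_measurable M"
      "\<And>\<omega>. \<omega> \<in> space M \<Longrightarrow> continuous_on {0..} (\<lambda>t. B1 t \<omega>) \<and> B1 0 \<omega> = 0"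
      "AE \<omega> in M. \<forall>t. B1 t \<omega> = B t \<omega>"
    using AE_version[of "\<lambda>b. continuous_on {0..} b \<and> b 0 = 0" B M, OF brownian_vec_paths[OF B] _ brownian_vec_measurable[OF B]]
    by auto
  have moment: "(\<integral>\<^sup>+\<omega>. ennreal ((norm (B1 t \<omega> - B1 s \<omega>))\<^sup>2) \<partial>M) = ennreal (real CARD('n) * \<bar>t - s\<bar>)"
    if "0 \<le> s" "0 \<le> t" for s t
    using B1(3) unfolding brownian_increment_norm_moment[OF B that, symmetric]
    by (intro nn_integral_cong_AE) (auto elim!: eventually_mono)
  have "AE \<omega> in M. admissible (\<lambda>t. B1 t \<omega>)"
    by (rule AE_admissible[OF sigma_finite_measure_axioms B1(1,2) moment]) auto
  moreover have "admissible (\<lambda>_. 0)" by (simp add: admissible_def set_integrable_def)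
  ultimately obtain B' where B': "\<And>t. 0 \<le> t \<Longrightarrow> B' t \<in> borel_measurable M"
      "\<And>\<omega>. \<omega> \<in> space M \<Longrightarrow> admissible (\<lambda>t. B' t \<omega>)" "AE \<omega> in M. \<forall>t. B' t \<omega> = B1 t \<omega>"
    using AE_version[of admissible B1 M, OF _ _ B1(1)] by blast
  have "AE \<omega> in M. \<forall>t. B' t \<omega> = B t \<omega>"
    using B'(3) B1(3) by eventually_elim simp
  then show ?thesis using that B'(1,2) by blast
qed

text \<open>The process \<open>Y t = B' t + A *v conv B' t\<close> built from an admissible version \<open>B'\<close> is continuous, is a version of
the Wiener integral for every \<open>t > 0\<close> and solves the equation path by path. Every other continuous
modification has almost surely the same paths.\<close>

theorem flow_process_solves_equation:
  fixes B Z :: "real \<Rightarrow> 'a \<Rightarrow> real ^ 'n"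
  assumes B: "standard_brownian_motion_vec M B"
    and Z0: "\<And>\<omega>. \<omega> \<in> space M \<Longrightarrow> Z 0 \<omega> = 0"
    and Z: "\<And>t. t > 0 \<Longrightarrow> AE \<omega> in M. Z t \<omega> = wiener_integral M B t (\<lambda>s. E (ln (t / s))) \<omega>"
  shows "\<exists>Z'. continuous_modification M Z Z'"
    and "continuous_modification M Z Z' \<Longrightarrow> AE \<omega> in M. \<forall>t\<ge>0.
      set_integrable lborel {0..t} (\<lambda>s. (1 / s) *\<^sub>R (A *v Z' s \<omega>)) \<and>
      Z' t \<omega> = B t \<omega> + (LINT s:{0..t}|lborel. (1 / s) *\<^sub>R (A *v Z' s \<omega>))"
proof -
  interpret mv: bounded_bilinear "(*v) :: real ^ 'n ^ 'n \<Rightarrow> real ^ 'n \<Rightarrow> real ^ 'n"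
    by (rule bounded_bilinear_matrix_vector_mult)
  have "prob_space M" using B by (simp add: standard_brownian_motion_vec_def standard_brownian_motion_def)
  then interpret prob_space M .
  obtain B' where B': "\<And>t. 0 \<le> t \<Longrightarrow> B' t \<in> borel_measurable M"
      "\<And>\<omega>. \<omega> \<in> space M \<Longrightarrow> admissible (\<lambda>t. B' t \<omega>)" "AE \<omega> in M. \<forall>t. B' t \<omega> = B t \<omega>"
    using brownian_admissible_version[OF B] by blast
  have moment: "(\<integral>\<^sup>+\<omega>. ennreal ((norm (B' t \<omega> - B' s \<omega>))\<^sup>2) \<partial>M) = ennreal (real CARD('n) * \<bar>t - s\<bar>)"
    if "0 \<le> s" "0 \<le> t" for s t
    using B'(3) unfolding brownian_increment_norm_moment[OF B that, symmetric]
    by (intro nn_integral_cong_AE) (auto elim!: eventually_mono)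
  define Y where "Y t \<omega> = B' t \<omega> + A *v conv (\<lambda>s. B' s \<omega>) t" for t \<omega>
  have Y_wiener: "has_wiener_integral M B t (\<lambda>s. E (ln (t / s))) (Y t)" if "0 < t" for t
  proof (rule has_wiener_integral_cong_AE)
    show "has_wiener_integral M B' t (\<lambda>s. E (ln (t / s))) (Y t)"
      unfolding Y_def[abs_def]
      by (rule has_wiener_integral_flow[OF sigma_finite_measure_axioms B'(1,2) moment _ that]) auto
    show "AE \<omega> in M. \<forall>t\<ge>0. B' t \<omega> = B t \<omega>"
      using B'(3) by eventually_elim simp
  qed
  have Y0: "Y 0 \<omega> = 0" if "\<omega> \<in> space M" for \<omega>
    using B'(2)[OF that] by (simp add: Y_def admissible_def mv.zero_right)
  have Y_cont: "continuous_on {0..} (\<lambda>t. Y t \<omega>)" if "\<omega> \<in> space M" for \<omega>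
    using B'(2)[OF that] continuous_on_conv[OF B'(2)[OF that]] unfolding Y_def
    by (intro continuous_on_add mv.continuous_on continuous_on_const) (auto simp: admissible_def)
  have Y_meas: "Y t \<in> borel_measurable M" if "0 \<le> t" for t
  proof (cases "t = 0")
    case True
    then show ?thesis using Y0 by (subst measurable_cong[where g = "\<lambda>_. 0"]) auto
  next
    case False
    then show ?thesis using Y_wiener[of t] that by (simp add: has_wiener_integral_def)
  qed
  have Y_Z: "AE \<omega> in M. Y t \<omega> = Z t \<omega>" if "0 \<le> t" for t
  proof (cases "t = 0")
    case True
    then show ?thesis using Y0 Z0 by (intro AE_I2) auto
  next
    case False
    then have t: "0 < t" using that by simp
    have "has_wiener_integral M B t (\<lambda>s. E (ln (t / s))) (wiener_integral M B t (\<lambda>s. E (ln (t / s))))"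
      unfolding wiener_integral_def
      by (rule someI[of "has_wiener_integral M B t (\<lambda>s. E (ln (t / s)))", OF Y_wiener[OF t]])
    then have "AE \<omega> in M. Y t \<omega> = wiener_integral M B t (\<lambda>s. E (ln (t / s))) \<omega>"
      by (rule has_wiener_integral_unique[OF B Y_wiener[OF t]])
    then show ?thesis using Z[OF t] by eventually_elim simp
  qed
  show "\<exists>Z'. continuous_modification M Z Z'"
    using Y_meas Y_Z Y_cont by (intro exI[of _ Y]) (simp add: continuous_modification_def)
  assume Z': "continuous_modification M Z Z'"
  have "AE \<omega> in M. Z' t \<omega> = Y t \<omega>" if "0 \<le> t" for t
  proof -
    have "AE \<omega> in M. Z' t \<omega> = Z t \<omega>" using Z' that by (simp add: continuous_modification_def)
    then show ?thesis using Y_Z[OF that] by eventually_elim simp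
  qed
  then have "AE \<omega> in M. \<forall>t\<ge>0. Z' t \<omega> = Y t \<omega>"
    using Z' Y_cont by (intro AE_eq_processes) (auto simp: continuous_modification_def)
  then show "AE \<omega> in M. \<forall>t\<ge>0.
      set_integrable lborel {0..t} (\<lambda>s. (1 / s) *\<^sub>R (A *v Z' s \<omega>)) \<and>
      Z' t \<omega> = B t \<omega> + (LINT s:{0..t}|lborel. (1 / s) *\<^sub>R (A *v Z' s \<omega>))"
    using B'(3) AE_space
  proof eventually_elim
    case (elim \<omega>)
    show ?case
    proof (intro allI impI)
      fix t :: real assume t: "0 \<le> t"
      define g where "g s = (1 / s) *\<^sub>R Y s \<omega>" for s
      have g: "set_integrable lborel {0..t} g" "conv (\<lambda>s. B' s \<omega>) t = (LINT s:{0..t}|lborel. g s)"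
        using conv_integral_equation[OF B'(2)[OF elim(3)] t] by (auto simp: g_def[abs_def] Y_def)
      have eq: "indicator {0..t} s *\<^sub>R ((1 / s) *\<^sub>R (A *v Z' s \<omega>)) = A *v (indicator {0..t} s *\<^sub>R g s)" for s
        using elim(1) by (auto simp: g_def mv.scaleR_right split: split_indicator)
      have "set_integrable lborel {0..t} (\<lambda>s. (1 / s) *\<^sub>R (A *v Z' s \<omega>))"
        using integrable_bounded_linear[OF mv.bounded_linear_right[of A] g(1)[unfolded set_integrable_def]]
        by (simp only: set_integrable_def eq)
      moreover have "(LINT s:{0..t}|lborel. (1 / s) *\<^sub>R (A *v Z' s \<omega>)) = A *v conv (\<lambda>s. B' s \<omega>) t"
        using integral_bounded_linear[OF mv.bounded_linear_right[of A] g(1)[unfolded set_integrable_def]]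
        by (simp only: set_lebesgue_integral_def eq g(2))
      ultimately show "set_integrable lborel {0..t} (\<lambda>s. (1 / s) *\<^sub>R (A *v Z' s \<omega>)) \<and>
          Z' t \<omega> = B t \<omega> + (LINT s:{0..t}|lborel. (1 / s) *\<^sub>R (A *v Z' s \<omega>))"
        using elim t by (simp add: Y_def)
    qed
  qed
qed

end

theorem proposition3p4:
  fixes M :: "'a measure"
    and B Z :: "real \<Rightarrow> 'a \<Rightarrow> real ^ 2"
    and \<alpha>1 \<alpha>2 :: real
    and A :: "real ^ 2 ^ 2"
  assumes "\<alpha>1 \<in> {-1..1}" and "\<alpha>2 \<in> {-1..1}"
    and "A = vector [vector [0, \<alpha>1], vector [\<alpha>2, 0]]"
    and "standard_brownian_motion_vec M B"
    and "\<alpha>1 * \<alpha>2 < 1 / 4"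
    and "\<And>\<omega>. \<omega> \<in> space M \<Longrightarrow> Z 0 \<omega> = 0"
    and "\<And>t. t > 0 \<Longrightarrow>
           AE \<omega> in M. Z t \<omega> = wiener_integral M B t (\<lambda>s. matrix_powr (t / s) A) \<omega>"
  shows "(\<exists>Z'. continuous_modification M Z Z') \<and>
         (\<forall>Z'. continuous_modification M Z Z' \<longrightarrow>
            (AE \<omega> in M. \<forall>t\<ge>0.
               set_integrable lborel {0..t} (\<lambda>s. (1 / s) *\<^sub>R (A *v Z' s \<omega>)) \<and>
               Z' t \<omega> = B t \<omega> + (LINT s:{0..t}|lborel. (1 / s) *\<^sub>R (A *v Z' s \<omega>))))"
proof -
  have "A ** A = (\<alpha>1 * \<alpha>2) *\<^sub>R mat 1"
    unfolding assms(3) by (simp add: vec_eq_iff forall_2 matrix_matrix_mult_def sum_2 mat_def)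
  then obtain K \<kappa> where "subcritical_flow A (\<lambda>u. matrix_exp (u *\<^sub>R A)) K \<kappa>"
    using subcritical_flow_matrix_exp assms(5) by blast
  then interpret subcritical_flow A "\<lambda>u. matrix_exp (u *\<^sub>R A)" K \<kappa> .
  show ?thesis
    using flow_process_solves_equation[of M B Z, OF assms(4) assms(6) assms(7)[unfolded matrix_powr_def]]
    by blast
qed

end
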